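(* Let $(\mathfrak{M},d)$ be a complete metric space, $1<p<\infty$, $\mathcal{E}:\mathfrak{M}\to(-\infty,+\infty]$ a proper, lower semicontinuous functional and $g$ a proper strong upper gradient of $\mathcal{E}$. Then the following statements hold. (1) Suppose $g$ is lower semicontinuous and for $\varphi\in\mathfrak{M}$ with $g(\varphi)=0$ there is $\varepsilon>0$ such that: $\mathcal{E}$ is bounded from below on $B(\varphi,\varepsilon)$; for all $v_0\in D(\mathcal{E})\cap B(\varphi,\varepsilon)$ there is a $p$-gradient flow $v$ of $\mathcal{E}$ with $v(0+)=v_0$; $$\overline{B}(\varphi,\varepsilon)\cap\{\mathcal{E}(\cdot|\varphi)\ne0\}\subseteq\{g>0\};$$ and there is a strictly increasing $\theta\in W^{1,1}_{loc}(\mathbb{R})$ with $\theta(0)=0$ and $|\{\theta\neq0,\theta'=0\}|=0$ such that $\theta'(\mathcal{E}(u|\varphi))\,g(u)\ge1$ for all $$u\in\mathcal{U}_\varepsilon:=B(\varphi,\varepsilon)\cap\{\mathcal{E}(\cdot|\varphi)\ne0\}\cap\{\theta'(\mathcal{E}(\cdot|\varphi))>0\}.$$ Then, if $\varphi$ is Lyapunov stable, $\varphi$ is a local minimum of $\mathcal{E}$. (2) Suppose for $\varphi\in\mathfrak{M}$ with $g(\varphi)=0$ there is $\varepsilon>0$ such that: for every $\eta>0$ there is $0<\delta\le\varepsilon$ with $\mathcal{E}(u|\varphi)<\eta$ for all $u\in B(\varphi,\delta)\cap D(\mathcal{E})$; $\overline{B}(\varphi,\varepsilon)\cap\{\mathcal{E}(\cdot|\varphi)\ne0\}\subseteq\{g>0\}$;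 and there is a strictly increasing $\theta\in W^{1,1}_{loc}(\mathbb{R})$ with $\theta(0)=0$ and $|\{\theta\ne0,\theta'=0\}|=0$ such that $\theta'(\mathcal{E}(u|\varphi))\,g(u)\ge1$ for all $u\in\mathcal{U}_\varepsilon$ ($\mathcal{U}_\varepsilon$ defined by the formula in (1)). Then, if $\varphi$ is a local minimum of $\mathcal{E}$, $\varphi$ is Lyapunov stable.
   Context: $p'=p/(p-1)$; $D(\mathcal{E})=\{\mathcal{E}<+\infty\}$; proper means not identically $+\infty$; $\mathcal{E}(u|\varphi):=\mathcal{E}(u)-\mathcal{E}(\varphi)$; $B$, $\overline B$ are the open ball and its closure; $|A|$ is Lebesgue measure; $v(0+):=\lim_{t\downarrow0}v(t)$ in $\mathfrak{M}$. $\varphi\in D(\mathcal{E})$ is a local minimum of $\mathcal{E}$ if for some $r>0$, $\mathcal{E}(\varphi)\le\mathcal{E}(u)$ for all $u\in B(\varphi,r)$. $AC(a,b;\mathfrak{M})$ (resp. $AC_{loc}$): curves $v$ with $d(v(s),v(t))\le\int_s^tm(r)\,dr$ for all $a<s\le t<b$ and some $m\in L^1(a,b)$ (resp. $L^1_{loc}$); $|v'|(t)=\lim_{s\to t}d(v(s),v(t))/|s-t|$ (exists a.e.). A proper $g:\mathfrak{M}\to[0,+\infty]$ with $\{g<\infty\}\subseteq D(\mathcal{E})$ is a strong upper gradient of $\mathcal{E}$ if for every $v\in AC(a,b;\mathfrak{M})$, $g\circ v$ is Borel and $|\mathcal{E}(v(t))-\mathcal{E}(v(s))|\le\int_s^tg(v(r))|v'|(r)\,dr$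 for $a<s\le t<b$. $v:[0,\infty)\to\mathfrak{M}$ is a $p$-gradient flow of $\mathcal{E}$ if $v\in AC_{loc}(0,\infty;\mathfrak{M})$, $\mathcal{E}\circ v:(0,\infty)\to\mathbb{R}$ is non-increasing and $\frac{d}{dt}\mathcal{E}(v(t))\le-\frac1{p'}g^{p'}(v(t))-\frac1p|v'|^p(t)$ for a.e. $t>0$. $\varphi$ (with $g(\varphi)=0$) is Lyapunov stable if for every $\varepsilon'>0$ there is $\delta>0$ such that for every $v_0\in B(\varphi,\delta)\cap D(\mathcal{E})$ and every $p$-gradient flow $v$ of $\mathcal{E}$ with $v(0+)=v_0$ one has $v(t)\in B(\varphi,\varepsilon')$ for all $t\ge0$. Elements of $W^{1,1}_{loc}(\mathbb{R})$ are identified with continuous representatives; $\theta'$ is the a.e. derivative.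
   Formalization: In part (1) the p-gradient flow v with v(0+)=v_0 that is assumed to exist must also satisfy E(v(t)) ≤ E(v_0) for all t>0; without this the claim is false, since the energy may blow up as t↓0 even though E(v_0) is finite. *)

theory Defs
  imports "HOL-Analysis.Analysis"
begin

text \<open>
  The metric space is the type \<^typ>\<open>'a\<close>.  A curve is a total function on the reals of which only
  the restriction to the interval in question matters.
\<close>

definition lsc :: "('a::topological_space \<Rightarrow> 'b::complete_linorder) \<Rightarrow> bool" where
  "lsc f \<longleftrightarrow> (\<forall>x. f x \<le> Liminf (at x) f)"

definition eff_domain :: "('a \<Rightarrow> ereal) \<Rightarrow> 'a set" where
  "eff_domain E = {u. E u < \<infinity>}"

definition local_minimum :: "('a::metric_space \<Rightarrow> ereal) \<Rightarrow> 'a \<Rightarrow> bool" where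
  "local_minimum E \<phi> \<longleftrightarrow> \<phi> \<in> eff_domain E \<and> (\<exists>r>0. \<forall>u\<in>ball \<phi> r. E \<phi> \<le> E u)"

text \<open>Only used with \<^term>\<open>E \<phi>\<close> finite, so that no difference of infinities occurs.\<close>

definition rel_energy :: "('a \<Rightarrow> ereal) \<Rightarrow> 'a \<Rightarrow> 'a \<Rightarrow> ereal" where
  "rel_energy E \<phi> u = E u - E \<phi>"

subsection \<open>Absolutely continuous curves and strong upper gradients\<close>

definition L1_loc :: "ereal \<Rightarrow> ereal \<Rightarrow> (real \<Rightarrow> real) \<Rightarrow> bool" where
  "L1_loc a b m \<longleftrightarrow>
     (\<forall>s t. a < ereal s \<longrightarrow> s \<le> t \<longrightarrow> ereal t < b \<longrightarrow> set_integrable lborel {s..t} m)"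

definition AC :: "ereal \<Rightarrow> ereal \<Rightarrow> (real \<Rightarrow> 'a::metric_space) \<Rightarrow> bool" where
  "AC a b v \<longleftrightarrow> (\<exists>m. set_integrable lborel (einterval a b) m \<and>
     (\<forall>s t. a < ereal s \<longrightarrow> s \<le> t \<longrightarrow> ereal t < b \<longrightarrow>
        dist (v s) (v t) \<le> (LINT r:{s..t}|lborel. m r)))"

definition AC_loc :: "ereal \<Rightarrow> ereal \<Rightarrow> (real \<Rightarrow> 'a::metric_space) \<Rightarrow> bool" where
  "AC_loc a b v \<longleftrightarrow> (\<exists>m. L1_loc a b m \<and>
     (\<forall>s t. a < ereal s \<longrightarrow> s \<le> t \<longrightarrow> ereal t < b \<longrightarrow>
        dist (v s) (v t) \<le> (LINT r:{s..t}|lborel. m r)))"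

definition metric_derivative :: "(real \<Rightarrow> 'a::metric_space) \<Rightarrow> real \<Rightarrow> real" where
  "metric_derivative v t = Lim (at t) (\<lambda>s. dist (v s) (v t) / \<bar>s - t\<bar>)"

text \<open>
  The energy inequality is not imposed when both energies are infinite: \<open>\<infinity> - \<infinity>\<close> is \<open>\<infinity>\<close> in
  \<^typ>\<open>ereal\<close>, which would already rule out constant curves outside the effective domain.
  If exactly one energy is infinite, the integral is forced to be infinite.
\<close>

definition strong_upper_gradient ::
    "('a::metric_space \<Rightarrow> ereal) \<Rightarrow> ('a \<Rightarrow> ennreal) \<Rightarrow> bool" where
  "strong_upper_gradient E g \<longleftrightarrow>
     (\<exists>u. g u < \<infinity>) \<and> {u. g u < \<infinity>} \<subseteq> eff_domain E \<and>
     (\<forall>a b v. a < b \<and> AC a b v \<longrightarrow>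
        (\<lambda>r. g (v r)) \<in> borel_measurable (restrict_space borel (einterval a b)) \<and>
        (\<forall>s t. a < ereal s \<longrightarrow> s \<le> t \<longrightarrow> ereal t < b \<longrightarrow> E (v s) < \<infinity> \<or> E (v t) < \<infinity> \<longrightarrow>
           \<bar>E (v t) - E (v s)\<bar> \<le>
             enn2ereal (\<integral>\<^sup>+r\<in>{s..t}. (g (v r) * ennreal (metric_derivative v r)) \<partial>lborel)))"

subsection \<open>Gradient flows and Lyapunov stability\<close>

text \<open>
  An infinite value of \<^term>\<open>g\<close> makes the right-hand side of the energy inequality \<open>-\<infinity>\<close>,
  so the inequality includes that \<^term>\<open>g (v t)\<close> is finite.
\<close>

definition p_gradient_flow ::
    "real \<Rightarrow> ('a::metric_space \<Rightarrow> ereal) \<Rightarrow> ('a \<Rightarrow> ennreal) \<Rightarrow> (real \<Rightarrow> 'a) \<Rightarrow> bool" where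
  "p_gradient_flow p E g v \<longleftrightarrow>
     AC_loc 0 \<infinity> v \<and>
     (\<forall>t>0. v t \<in> eff_domain E) \<and>
     (\<forall>s t. 0 < s \<longrightarrow> s \<le> t \<longrightarrow> E (v t) \<le> E (v s)) \<and>
     (let p' = p / (p - 1) in
        AE t in lborel. 0 < t \<longrightarrow>
          g (v t) < \<infinity> \<and>
          (\<exists>D. ((\<lambda>s. real_of_ereal (E (v s))) has_real_derivative D) (at t) \<and>
             D \<le> - (1 / p') * enn2real (g (v t)) powr p' - (1 / p) * metric_derivative v t powr p))"

text \<open>
  The flow is a curve on \<open>[0,\<infinity>)\<close>, but the flow conditions do not see its value at \<open>0\<close>;
  having initial value \<open>v\<^sub>0\<close> includes that this value is \<open>v(0+) = v\<^sub>0\<close>.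

  Monotonicity of the energy on \<open>(0,\<infinity>)\<close> does not give \<open>E (v t) \<le> E v\<^sub>0\<close>: lower semicontinuity
  allows \<open>E (v t)\<close> to tend to \<open>\<infinity>\<close> as \<open>t\<close> decreases to \<open>0\<close> although \<open>E v\<^sub>0\<close> is finite.
  Where existence of flows is assumed, the bound by \<open>E v\<^sub>0\<close> (monotonicity on all of
  \<open>[0,\<infinity>)\<close>) is therefore stated separately.  Lyapunov stability refers to all flows.
\<close>

definition initial_value :: "(real \<Rightarrow> 'a::metric_space) \<Rightarrow> 'a \<Rightarrow> bool" where
  "initial_value v v0 \<longleftrightarrow> (v \<longlongrightarrow> v0) (at_right 0) \<and> v 0 = v0"

definition Lyapunov_stable ::
    "real \<Rightarrow> ('a::metric_space \<Rightarrow> ereal) \<Rightarrow> ('a \<Rightarrow> ennreal) \<Rightarrow> 'a \<Rightarrow> bool" where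
  "Lyapunov_stable p E g \<phi> \<longleftrightarrow> g \<phi> = 0 \<and>
     (\<forall>\<epsilon>'>0. \<exists>\<delta>>0. \<forall>v0 \<in> ball \<phi> \<delta> \<inter> eff_domain E. \<forall>v.
        p_gradient_flow p E g v \<and> initial_value v v0 \<longrightarrow> (\<forall>t\<ge>0. v t \<in> ball \<phi> \<epsilon>'))"

subsection \<open>The Kurdyka-Lojasiewicz inequality\<close>

text \<open>
  Continuous representatives of elements of \<open>W\<^sup>1\<^sup>,\<^sup>1\<^sub>l\<^sub>o\<^sub>c(\<real>)\<close>; \<open>f\<close> is the weak derivative, tested
  against continuously differentiable functions \<open>\<psi>\<close> with compact support.
\<close>

definition W11_loc :: "(real \<Rightarrow> real) \<Rightarrow> bool" where
  "W11_loc \<theta> \<longleftrightarrow> continuous_on UNIV \<theta> \<and>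
     (\<exists>f. L1_loc (-\<infinity>) \<infinity> f \<and>
        (\<forall>\<psi> \<psi>'. (\<forall>x. (\<psi> has_real_derivative \<psi>' x) (at x)) \<and> continuous_on UNIV \<psi>' \<and>
                 (\<exists>R. \<forall>x. \<bar>x\<bar> > R \<longrightarrow> \<psi> x = 0) \<longrightarrow>
           (LINT x|lborel. \<theta> x * \<psi>' x) = - (LINT x|lborel. f x * \<psi> x)))"

text \<open>
  \<open>\<theta>'\<close> is an everywhere defined version of the almost everywhere derivative of \<open>\<theta>\<close>.  Any version
  is admitted, in particular the one equal to \<open>0\<close> wherever \<open>\<theta>\<close> is not differentiable.
\<close>

definition KL_function :: "(real \<Rightarrow> real) \<Rightarrow> (real \<Rightarrow> real) \<Rightarrow> bool" where
  "KL_function \<theta> \<theta>' \<longleftrightarrow>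
     strict_mono \<theta> \<and> W11_loc \<theta> \<and> \<theta> 0 = 0 \<and>
     (AE x in lborel. (\<theta> has_real_derivative \<theta>' x) (at x)) \<and>
     {x. \<theta> x \<noteq> 0 \<and> \<theta>' x = 0} \<in> null_sets lebesgue"

text \<open>
  Points of infinite energy are left out, as \<open>\<theta>'\<close> is only defined on the reals; a strong upper
  gradient is infinite there anyway.
\<close>

definition KL_set :: "('a::metric_space \<Rightarrow> ereal) \<Rightarrow> 'a \<Rightarrow> real \<Rightarrow> (real \<Rightarrow> real) \<Rightarrow> 'a set" where
  "KL_set E \<phi> \<epsilon> \<theta>' =
     ball \<phi> \<epsilon> \<inter> {u. rel_energy E \<phi> u \<noteq> 0} \<inter>
     {u. u \<in> eff_domain E \<and> \<theta>' (real_of_ereal (rel_energy E \<phi> u)) > 0}"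

definition KL_inequality ::
    "('a::metric_space \<Rightarrow> ereal) \<Rightarrow> ('a \<Rightarrow> ennreal) \<Rightarrow> 'a \<Rightarrow> real \<Rightarrow> bool" where
  "KL_inequality E g \<phi> \<epsilon> \<longleftrightarrow>
     (\<exists>\<theta> \<theta>'. KL_function \<theta> \<theta>' \<and>
        (\<forall>u \<in> KL_set E \<phi> \<epsilon> \<theta>'. ennreal (\<theta>' (real_of_ereal (rel_energy E \<phi> u))) * g u \<ge> 1))"

end

theory Submission
  imports Defs
begin

text \<open>
  Along a gradient flow \<open>v\<close> inside the ball, with \<open>h t = E (v t) - E \<phi>\<close>, the Kurdyka-Lojasiewicz
  inequality and Young's inequality give \<open>\<bar>v'\<bar> \<le> - (\<theta> \<circ> h)'\<close> almost everywhere, whence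
  \<open>dist (v s) (v t) \<le> \<theta> (h s) - \<theta> (h t)\<close>.
  Near a local minimum the right-hand side is at most \<open>\<theta> (h s)\<close>, which is small, so a flow starting
  close to \<open>\<phi>\<close> cannot leave the ball.
  Conversely, if \<open>\<phi>\<close> is stable but not a local minimum, a flow starting close to \<open>\<phi>\<close> with \<open>h < 0\<close>
  stays in the ball and has finite length, so it converges; its limit still has \<open>h < 0\<close>, but zero
  slope because the energy stays bounded below, which the assumption on critical points excludes.

  The exceptional null set of \<open>\<theta>\<close> is harmless, since its preimage under \<open>h\<close> is null up to points
  where \<open>h'\<close> vanishes, and there the speed vanishes as well.
\<close>

subsection \<open>Almost everywhere existence of the metric derivative\<close>

text \<open>The flow inequality bounds the speed through \<open>metric_derivative\<close>, a
  \<open>Lim\<close> whose value carries no information where the limit does not exist. Existence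
  almost everywhere therefore has to be proved; it is obtained by comparing the curve with its
  variation function. Integrating the pointwise speed bound directly would require absolute
  continuity of \<open>\<theta> \<circ> h\<close>. Only its monotonicity is used instead: a singular
  part of \<open>\<theta> \<circ> h\<close> can only decrease, which is the favourable sign. So
  \<open>dist (v s) (v t) + \<theta> (h t)\<close> is treated as a single function of
  \<open>t\<close>. Its upward increments are bounded by the integral of an integrable function, and
  for such functions a right slope that is nonpositive almost everywhere already forces the values
  not to increase.\<close>

definition monotone_majorant :: "(real \<Rightarrow> 'a::metric_space) \<Rightarrow> real \<Rightarrow> real \<Rightarrow> (real \<Rightarrow> real) \<Rightarrow> bool" where
  "monotone_majorant f a b M \<longleftrightarrow>
     (\<forall>s t. a \<le> s \<longrightarrow> s \<le> t \<longrightarrow> t \<le> b \<longrightarrow> dist (f s) (f t) \<le> M t - M s)"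

text \<open>Up to a constant this is the variation function of \<open>f\<close>. Minimality is
  demanded of the total increment only; lowering the increments of a majorant on a part of
  \<open>{a..b}\<close> would lower the total as well.\<close>

definition minimal_majorant :: "(real \<Rightarrow> 'a::metric_space) \<Rightarrow> real \<Rightarrow> real \<Rightarrow> (real \<Rightarrow> real) \<Rightarrow> bool" where
  "minimal_majorant f a b l \<longleftrightarrow> monotone_majorant f a b l \<and>
     (\<forall>M. monotone_majorant f a b M \<longrightarrow> l b - l a \<le> M b - M a)"

lemma monotone_majorantD:
  "monotone_majorant f a b M \<Longrightarrow> a \<le> s \<Longrightarrow> s \<le> t \<Longrightarrow> t \<le> b \<Longrightarrow> dist (f s) (f t) \<le> M t - M s"
  by (auto simp: monotone_majorant_def)

lemma monotone_majorant_mono: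
  "monotone_majorant f a b M \<Longrightarrow> a \<le> s \<Longrightarrow> s \<le> t \<Longrightarrow> t \<le> b \<Longrightarrow> M s \<le> M t"
  using monotone_majorantD[of f a b M s t] zero_le_dist[of "f s" "f t"] by linarith

text \<open>Normalised to vanish at \<open>a\<close>, majorants are nonnegative, so their pointwise
  infimum exists. It is again a majorant because \<open>k s + dist (f s) (f t) \<le> k t\<close>
  survives taking the infimum over \<open>k\<close> on both sides.\<close>

lemma minimal_majorant_exists:
  fixes f :: "real \<Rightarrow> 'a::metric_space"
  assumes M: "monotone_majorant f a b M" and "a \<le> b"
  shows "\<exists>l. minimal_majorant f a b l"
proof -
  define V where "V t = (INF k\<in>Collect (monotone_majorant f a b). k t - k a)" for t
  have bdd: "bdd_below ((\<lambda>k. k t - k a) ` Collect (monotone_majorant f a b))"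
    if "a \<le> t" "t \<le> b" for t
    using that monotone_majorant_mono[of f a b _ a t] by (intro bdd_belowI[of _ 0]) auto
  have "dist (f s) (f t) \<le> V t - V s" if st: "a \<le> s" "s \<le> t" "t \<le> b" for s t
  proof -
    have "V s + dist (f s) (f t) \<le> V t"
      unfolding V_def[of t]
    proof (rule cINF_greatest)
      show "Collect (monotone_majorant f a b) \<noteq> {}" using M by auto
      fix k assume k: "k \<in> Collect (monotone_majorant f a b)"
      have "V s \<le> k s - k a"
        unfolding V_def using k bdd[of s] st by (intro cINF_lower) auto
      moreover have "dist (f s) (f t) \<le> k t - k s"
        using k st by (auto intro: monotone_majorantD)
      ultimately show "V s + dist (f s) (f t) \<le> k t - k a" by linarith
    qed
    then show ?thesis by simp
  qed
  then have "monotone_majorant f a b V"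
    by (auto simp: monotone_majorant_def)
  moreover have "V b - V a \<le> k b - k a" if "monotone_majorant f a b k" for k
  proof -
    have "V b \<le> k b - k a"
      unfolding V_def using that bdd[of b] \<open>a \<le> b\<close> by (intro cINF_lower) auto
    moreover have "V a = 0"
      unfolding V_def using M by (auto intro!: cINF_const)
    ultimately show ?thesis by simp
  qed
  ultimately show ?thesis
    unfolding minimal_majorant_def by blast
qed

text \<open>Subtracting the outer measure of \<open>A\<close> from a minimal majorant leaves a majorant.\<close>

lemma negligible_if_minimal_majorant_excess:
  fixes f :: "real \<Rightarrow> 'a::metric_space"
  assumes l: "minimal_majorant f a b l" and c: "0 < c" and "a < b" and A: "A \<subseteq> {a<..<b}"
    and excess: "\<And>x y. a \<le> x \<Longrightarrow> x < y \<Longrightarrow> y \<le> b \<Longrightarrow>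
      \<exists>T\<in>sets lebesgue. A \<inter> {x<..<y} \<subseteq> T \<and>
        emeasure lebesgue T \<le> ennreal ((l y - l x - dist (f x) (f y)) / c)"
  shows "negligible A"
proof -
  \<comment> \<open>Outer measure, because \<open>A\<close> is not assumed measurable; it is
    evaluated through measurable covers.\<close>
  define \<mu> where "\<mu> t = outer_measure_of lebesgue (A \<inter> {a..t})" for t
  define \<alpha> where "\<alpha> t = enn2real (\<mu> t)" for t
  have fin: "\<mu> t < \<infinity>" for t
  proof -
    have "\<mu> t \<le> outer_measure_of lebesgue {a..t}"
      unfolding \<mu>_def by (intro outer_measure_of_mono) auto
    also have "\<dots> < \<infinity>" by (simp add: emeasure_lborel_Icc_eq)
    finally show ?thesis .
  qed
  have step: "\<alpha> y \<le> \<alpha> x + (l y - l x - dist (f x) (f y)) / c" if "a \<le> x" "x \<le> y" "y \<le> b" for x y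
  proof (cases "x = y")
    case False
    with that have "x < y" by simp
    from excess[OF \<open>a \<le> x\<close> this \<open>y \<le> b\<close>] obtain T where T: "T \<in> sets lebesgue" "A \<inter> {x<..<y} \<subseteq> T"
      "emeasure lebesgue T \<le> ennreal ((l y - l x - dist (f x) (f y)) / c)" by blast
    have nonneg: "0 \<le> (l y - l x - dist (f x) (f y)) / c"
      using l c that by (auto simp: minimal_majorant_def dest: monotone_majorantD)
    obtain B where B: "B \<in> sets lebesgue" "A \<inter> {a..x} \<subseteq> B" "\<mu> x = emeasure lebesgue B"
      unfolding \<mu>_def using outer_measure_of_attain[of "A \<inter> {a..x}" lebesgue] by auto
    \<comment> \<open>The cover \<open>T\<close> reaches only the open interval, so the endpoint
      \<open>y\<close> is added at no cost.\<close>
    have "\<mu> y \<le> emeasure lebesgue (B \<union> T \<union> {y})"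
    proof -
      have "\<mu> y \<le> outer_measure_of lebesgue (B \<union> T \<union> {y})"
        unfolding \<mu>_def using B(2) T(2)
        proof (intro outer_measure_of_mono subsetI)
          fix z assume z: "z \<in> A \<inter> {a..y}"
          consider "z \<le> x" | "x < z" "z < y" | "z = y" using z by force
          then show "z \<in> B \<union> T \<union> {y}"
            using z B(2) T(2) by cases auto
        qed
      moreover have "B \<union> T \<union> {y} \<in> sets lebesgue"
        using B(1) T(1) by (intro sets.Un) auto
      ultimately show ?thesis by (simp only: outer_measure_of_eq)
    qed
    also have "\<dots> \<le> emeasure lebesgue (B \<union> T) + emeasure lebesgue {y}"
      using B T by (intro emeasure_subadditive) auto
    also have "\<dots> \<le> emeasure lebesgue B + emeasure lebesgue T"
      using emeasure_subadditive[OF B(1) T(1)] by simp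
    also have "\<dots> \<le> \<mu> x + ennreal ((l y - l x - dist (f x) (f y)) / c)"
      using B T by (intro add_mono) auto
    also have "\<dots> = ennreal (\<alpha> x + (l y - l x - dist (f x) (f y)) / c)"
      using fin[of x] nonneg by (simp add: \<alpha>_def ennreal_plus less_top)
    finally have "ennreal (\<alpha> y) \<le> ennreal (\<alpha> x + (l y - l x - dist (f x) (f y)) / c)"
      using fin[of y] by (simp add: \<alpha>_def less_top)
    moreover have "0 \<le> \<alpha> x" by (simp add: \<alpha>_def)
    ultimately show ?thesis using nonneg by (subst (asm) ennreal_le_iff) auto
  qed (use that in auto)
  have "monotone_majorant f a b (\<lambda>t. l t - c * \<alpha> t)"
    unfolding monotone_majorant_def
  proof (intro allI impI)
    fix s t assume "a \<le> s" "s \<le> t" "t \<le> b"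
    from step[OF this] c show "dist (f s) (f t) \<le> l t - c * \<alpha> t - (l s - c * \<alpha> s)"
      by (simp add: field_simps)
  qed
  with l have "l b - l a \<le> (l b - c * \<alpha> b) - (l a - c * \<alpha> a)"
    unfolding minimal_majorant_def by blast
  moreover have "\<alpha> a = 0"
  proof -
    have "A \<inter> {a..a} = {}" using A by auto
    then show ?thesis unfolding \<alpha>_def \<mu>_def by simp
  qed
  moreover have "0 \<le> \<alpha> b" by (simp add: \<alpha>_def)
  ultimately have "\<alpha> b = 0" using c by (simp add: mult_le_0_iff)
  then have "\<mu> b = 0" using fin[of b] by (auto simp: \<alpha>_def enn2real_eq_0_iff)
  moreover have "A \<inter> {a..b} = A" using A by auto
  ultimately obtain B where "B \<in> sets lebesgue" "A \<subseteq> B" "emeasure lebesgue B = 0"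
    unfolding \<mu>_def using outer_measure_of_attain[of A lebesgue] by auto
  then show ?thesis
    by (meson negligible_iff_null_sets negligible_subset null_setsI)
qed

text \<open>A disjoint Vitali subfamily of the intervals in the last assumption covers
  \<open>S\<close> up to a null set. Their images under \<open>k\<close> do not overlap and lie
  inside \<open>{k x..k y}\<close>, so \<open>c\<close> times their total length is at most
  \<open>k y - k x\<close>. The conclusion speaks of a measurable cover since \<open>S\<close> need
  not be measurable.\<close>

lemma vitali_growth:
  fixes k :: "real \<Rightarrow> real"
  assumes "x \<le> y" and mono: "\<And>s t. x \<le> s \<Longrightarrow> s \<le> t \<Longrightarrow> t \<le> y \<Longrightarrow> k s \<le> k t" and c: "0 < c"
    and S: "\<And>t d. t \<in> S \<Longrightarrow> 0 < d \<Longrightarrow>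
      \<exists>p q. x \<le> p \<and> p < q \<and> q \<le> y \<and> p \<le> t \<and> t \<le> q \<and> q - p < d \<and> c * (q - p) \<le> k q - k p"
  shows "\<exists>T\<in>sets lebesgue. S \<subseteq> T \<and> emeasure lebesgue T \<le> ennreal ((k y - k x) / c)"
proof -
  \<comment> \<open>An interval is coded by its endpoints; \<open>m\<close> and \<open>r\<close>
    turn it into the ball that the covering theorem expects.\<close>
  define K where "K = {(p, q). x \<le> p \<and> p < q \<and> q \<le> y \<and> c * (q - p) \<le> k q - k p}"
  define m where "m = (\<lambda>(p, q). (p + q) / 2 :: real)"
  define r where "r = (\<lambda>(p, q). (q - p) / 2 :: real)"
  have cb: "cball (m (p, q)) (r (p, q)) = {p..q}" if "p \<le> q" for p q
    using that by (auto simp: m_def r_def cball_eq_atLeastAtMost field_simps)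
  have "\<exists>i. i \<in> K \<and> t \<in> cball (m i) (r i) \<and> r i < d" if t: "t \<in> S" "0 < d" for t d
  proof -
    obtain p q where pq: "x \<le> p" "p < q" "q \<le> y" "p \<le> t" "t \<le> q" "q - p < d" "c * (q - p) \<le> k q - k p"
      using S[OF t] by blast
    then have "(p, q) \<in> K" "t \<in> cball (m (p, q)) (r (p, q))" "r (p, q) < d"
      using cb[of p q] by (auto simp: K_def r_def)
    then show ?thesis by blast
  qed
  moreover have "0 < r i" if "i \<in> K" for i
    using that by (auto simp: K_def r_def)
  ultimately obtain C where C: "countable C" "C \<subseteq> K"
     "pairwise (\<lambda>i j. disjnt (cball (m i) (r i)) (cball (m j) (r j))) C"
     "negligible (S - (\<Union>i \<in> C. cball (m i) (r i)))"
    by (rule_tac Vitali_covering_theorem_cballs[of K r S m]) auto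
  define U where "U = (\<Union>i\<in>C. cball (m i) (r i))"
  define N where "N = S - U"
  have disj: "disjoint_family_on (\<lambda>i. cball (m i) (r i)) C"
    using C(3) by (auto simp: disjoint_family_on_def pairwise_def disjnt_def)
  \<comment> \<open>The images are taken open: if \<open>k\<close> is constant between two
    neighbouring intervals, the closed images share an endpoint.\<close>
  have disj': "disjoint_family_on (\<lambda>(p, q). {k p<..<k q}) C"
    unfolding disjoint_family_on_def
  proof (intro ballI impI)
    fix i j assume ij: "i \<in> C" "j \<in> C" "i \<noteq> j"
    obtain p q p' q' where i: "i = (p, q)" and j: "j = (p', q')" by (metis surj_pair)
    have K: "x \<le> p" "p < q" "q \<le> y" "x \<le> p'" "p' < q'" "q' \<le> y"
      using ij C(2) i j by (auto simp: K_def)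
    have "{p..q} \<inter> {p'..q'} = {}"
      using pairwiseD[OF C(3) ij] K unfolding i j disjnt_def by (simp add: cb)
    then have "q < p' \<or> q' < p"
    proof (rule_tac ccontr)
      assume "\<not> (q < p' \<or> q' < p)"
      then have "max p p' \<in> {p..q} \<inter> {p'..q'}" using K by auto
      then show False using \<open>{p..q} \<inter> {p'..q'} = {}\<close> by blast
    qed
    then have "k q \<le> k p' \<or> k q' \<le> k p" using K mono by (meson less_imp_le order_trans)
    then show "(case i of (p, q) \<Rightarrow> {k p<..<k q}) \<inter> (case j of (p, q) \<Rightarrow> {k p<..<k q}) = {}"
      by (auto simp: i j)
  qed
  have U: "U \<in> sets lebesgue"
    unfolding U_def using C(1) by (intro sets.countable_UN'') auto
  have "emeasure lebesgue U = (\<integral>\<^sup>+i. emeasure lebesgue (cball (m i) (r i)) \<partial>count_space C)"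
    unfolding U_def using disj C(1) by (intro emeasure_UN_countable) auto
  also have "\<dots> \<le> (\<integral>\<^sup>+i. ennreal (1 / c) * emeasure lborel (case i of (p, q) \<Rightarrow> {k p<..<k q}) \<partial>count_space C)"
  proof (intro nn_integral_mono)
    fix i assume "i \<in> space (count_space C)"
    then obtain p q where i: "i = (p, q)" "p < q" "c * (q - p) \<le> k q - k p"
      using C(2) by (auto simp: K_def)
    then have le: "q - p \<le> (1 / c) * (k q - k p)" "k p \<le> k q"
      using c mult_pos_pos[OF c, of "q - p"] by (simp add: field_simps, linarith)
    have "emeasure lebesgue (cball (m i) (r i)) = ennreal (q - p)"
      using i by (simp add: cb)
    also have "\<dots> \<le> ennreal ((1 / c) * (k q - k p))"
      using le by (intro ennreal_leI)
    also have "\<dots> = ennreal (1 / c) * emeasure lborel {k p<..<k q}"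
      using le c by (simp add: ennreal_mult' flip: ennreal_mult'')
    finally show "emeasure lebesgue (cball (m i) (r i)) \<le>
        ennreal (1 / c) * emeasure lborel (case i of (p, q) \<Rightarrow> {k p<..<k q})"
      by (simp add: i)
  qed
  also have "\<dots> = ennreal (1 / c) * (\<integral>\<^sup>+i. emeasure lborel (case i of (p, q) \<Rightarrow> {k p<..<k q}) \<partial>count_space C)"
    by (intro nn_integral_cmult) auto
  also have "\<dots> = ennreal (1 / c) * emeasure lborel (\<Union>i\<in>C. case i of (p, q) \<Rightarrow> {k p<..<k q})"
    using disj' C(1) by (subst emeasure_UN_countable) auto
  also have "\<dots> \<le> ennreal (1 / c) * emeasure lborel {k x..k y}"
  proof (intro mult_left_mono emeasure_mono)
    show "(\<Union>i\<in>C. case i of (p, q) \<Rightarrow> {k p<..<k q}) \<subseteq> {k x..k y}"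
    proof (intro UN_least)
      fix i assume "i \<in> C"
      then obtain p q where i: "i = (p, q)" "x \<le> p" "p < q" "q \<le> y"
        using C(2) by (auto simp: K_def)
      then have "k x \<le> k p" "k q \<le> k y" by (auto intro: mono)
      then show "(case i of (p, q) \<Rightarrow> {k p<..<k q}) \<subseteq> {k x..k y}" by (auto simp: i)
    qed
  qed auto
  also have "\<dots> = ennreal ((k y - k x) / c)"
    using mono[of x y] \<open>x \<le> y\<close> c by (simp add: ennreal_mult' flip: ennreal_mult'')
  finally have "emeasure lebesgue U \<le> ennreal ((k y - k x) / c)" .
  moreover have N: "N \<in> null_sets lebesgue"
    using C(4) by (simp add: N_def U_def negligible_iff_null_sets)
  ultimately have "emeasure lebesgue (U \<union> N) \<le> ennreal ((k y - k x) / c)"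
    using U by (simp add: emeasure_Un_null_set)
  moreover have "U \<union> N \<in> sets lebesgue" using U N by (auto simp: null_sets_def)
  moreover have "S \<subseteq> U \<union> N" by (auto simp: N_def)
  ultimately show ?thesis by blast
qed

section \<open>Slopes of monotone functions and of minimal majorants\<close>

lemma frequently_at_real:
  fixes t :: real
  assumes "\<exists>\<^sub>F s in at t. P s" and "x < t" "t < y" "0 < d"
  shows "\<exists>s. P s \<and> s \<noteq> t \<and> x < s \<and> s < y \<and> \<bar>s - t\<bar> < d"
proof -
  have "t \<in> {x<..<y} \<inter> ball t d" using assms(2-4) by auto
  then have "\<forall>\<^sub>F s in at t. s \<in> {x<..<y} \<inter> ball t d - {t}"
    by (intro eventually_at_in_open) auto
  with assms(1) have "\<exists>\<^sub>F s in at t. P s \<and> s \<in> {x<..<y} \<inter> ball t d - {t}"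
    by (rule frequently_eventually_frequently)
  then obtain s where "P s" "s \<in> {x<..<y} \<inter> ball t d - {t}"
    using frequently_ex by blast
  then show ?thesis by (intro exI[of _ s]) (auto simp: dist_real_def abs_minus_commute)
qed

text \<open>This makes the slopes of \<open>l\<close> and \<open>f\<close> agree almost everywhere.
  By the triangle inequality, the increments of \<open>l t - dist (f x) (f t)\<close> on
  \<open>{x..y}\<close> dominate the excess of \<open>l\<close> over the distances of
  \<open>f\<close>, while its total increment is exactly the excess on \<open>{x..y}\<close>. A
  growth bound for this function is thus the cover required of an excess set.\<close>

lemma minimal_majorant_increment_negligible:
  fixes f :: "real \<Rightarrow> 'a::metric_space"
  assumes l: "minimal_majorant f a b l" and c: "0 < c"
  shows "negligible {t\<in>{a<..<b}. \<exists>\<^sub>F s in at t. c * \<bar>s - t\<bar> < \<bar>l s - l t\<bar> - dist (f s) (f t)}"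
    (is "negligible ?A")
proof (cases "a < b")
  case True
  have maj: "monotone_majorant f a b l" using l by (simp add: minimal_majorant_def)
  show ?thesis
  proof (rule negligible_if_minimal_majorant_excess[OF l c True])
    fix x y assume xy: "a \<le> x" "x < y" "y \<le> b"
    define k where "k t = l t - dist (f x) (f t)" for t
    have k_inc: "l t - l s - dist (f s) (f t) \<le> k t - k s" if "x \<le> s" "s \<le> t" "t \<le> y" for s t
      using dist_triangle[of "f x" "f t" "f s"] by (simp add: k_def)
    have "\<exists>T\<in>sets lebesgue. ?A \<inter> {x<..<y} \<subseteq> T \<and> emeasure lebesgue T \<le> ennreal ((k y - k x) / c)"
    proof (rule vitali_growth[where k = k and x = x and y = y])
      fix s t assume "x \<le> s" "s \<le> t" "t \<le> y"
      then show "k s \<le> k t"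
        using k_inc[of s t] monotone_majorantD[OF maj, of s t] xy by linarith
    next
      fix t d :: real assume t: "t \<in> ?A \<inter> {x<..<y}" and "0 < d"
      then obtain s where s: "c * \<bar>s - t\<bar> < \<bar>l s - l t\<bar> - dist (f s) (f t)" "s \<noteq> t" "x < s" "s < y" "\<bar>s - t\<bar> < d"
        using frequently_at_real[of "\<lambda>s. c * \<bar>s - t\<bar> < \<bar>l s - l t\<bar> - dist (f s) (f t)" t x y d] by auto
      define p q where "p = min s t" and "q = max s t"
      have "x \<le> p" "p < q" "q \<le> y" "p \<le> t" "t \<le> q" "q - p < d" "\<bar>s - t\<bar> = q - p"
        using s t by (auto simp: p_def q_def)
      moreover have "\<bar>l s - l t\<bar> = l q - l p"
        using monotone_majorant_mono[OF maj, of p q] xy calculation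
        by (auto simp: p_def q_def min_def max_def split: if_splits)
      moreover have "dist (f s) (f t) = dist (f p) (f q)"
        by (auto simp: p_def q_def min_def max_def dist_commute)
      ultimately show "\<exists>p q. x \<le> p \<and> p < q \<and> q \<le> y \<and> p \<le> t \<and> t \<le> q \<and> q - p < d \<and> c * (q - p) \<le> k q - k p"
        using s(1) k_inc[of p q] by (intro exI[of _ p] exI[of _ q]) auto
    qed (use xy c in auto)
    then show "\<exists>T\<in>sets lebesgue. ?A \<inter> {x<..<y} \<subseteq> T \<and>
        emeasure lebesgue T \<le> ennreal ((l y - l x - dist (f x) (f y)) / c)"
      by (simp add: k_def algebra_simps)
  qed auto
qed simp

text \<open>Subtracting a line whose slope is midway between \<open>\<alpha>\<close> and
  \<open>\<beta>\<close> turns the gap into slopes of both signs: the remainder \<open>f\<close> has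
  slopes below \<open>- r\<close> and above \<open>r\<close> at arbitrarily small scales. Such
  oscillation costs variation beyond the net change \<open>dist (f x) (f y)\<close>, so these points
  form an excess set for the variation function of \<open>f\<close>.\<close>

lemma mono_slope_gap_negligible:
  fixes l :: "real \<Rightarrow> real"
  assumes mono: "\<And>s t. a \<le> s \<Longrightarrow> s \<le> t \<Longrightarrow> t \<le> b \<Longrightarrow> l s \<le> l t" and "\<alpha> < \<beta>"
  shows "negligible {t\<in>{a<..<b}. (\<exists>\<^sub>F s in at t. (l s - l t) / (s - t) < \<alpha>) \<and>
                                  (\<exists>\<^sub>F s in at t. \<beta> < (l s - l t) / (s - t))}"
    (is "negligible ?A")
proof (cases "a < b")
  case True
  define \<gamma> where "\<gamma> = (\<alpha> + \<beta>) / 2"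
  define r where "r = (\<beta> - \<alpha>) / 2"
  have r: "0 < r" "\<alpha> = \<gamma> - r" "\<beta> = \<gamma> + r" using \<open>\<alpha> < \<beta>\<close> by (auto simp: r_def \<gamma>_def field_simps)
  define f where "f t = l t - \<gamma> * t" for t
  have "monotone_majorant f a b (\<lambda>t. l t + \<bar>\<gamma>\<bar> * t)"
    unfolding monotone_majorant_def
  proof (intro allI impI)
    fix s t assume st: "a \<le> s" "s \<le> t" "t \<le> b"
    have "dist (f s) (f t) \<le> \<bar>l t - l s\<bar> + \<bar>\<gamma> * (t - s)\<bar>"
      unfolding dist_real_def f_def right_diff_distrib by linarith
    also have "\<dots> = l t - l s + \<bar>\<gamma>\<bar> * (t - s)"
      using st mono[of s t] by (simp add: abs_mult)
    finally show "dist (f s) (f t) \<le> l t + \<bar>\<gamma>\<bar> * t - (l s + \<bar>\<gamma>\<bar> * s)"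
      by (simp add: algebra_simps)
  qed
  then obtain w where w: "minimal_majorant f a b w"
    using minimal_majorant_exists True by (meson less_imp_le)
  then have maj: "monotone_majorant f a b w" by (simp add: minimal_majorant_def)
  have "negligible ?A"
  proof (rule negligible_if_minimal_majorant_excess[OF w, of "2 * r"])
    fix x y assume xy: "a \<le> x" "x < y" "y \<le> b"
    define \<sigma> :: real where "\<sigma> = (if f x \<le> f y then 1 else - 1)"
    have \<sigma>: "\<bar>\<sigma>\<bar> = 1" "dist (f x) (f y) = \<sigma> * (f y - f x)" by (auto simp: \<sigma>_def dist_real_def)
    \<comment> \<open>An increment of \<open>f\<close> against its net direction
      \<open>\<sigma>\<close> counts twice in \<open>k\<close>, once in \<open>w\<close> and once in
      \<open>- \<sigma> * f\<close>; hence the constant \<open>2 * r\<close>.\<close>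
    define k where "k t = w t - \<sigma> * f t" for t
    have inc: "\<bar>f t - f s\<bar> - \<sigma> * (f t - f s) \<le> k t - k s" if "x \<le> s" "s \<le> t" "t \<le> y" for s t
      using monotone_majorantD[OF maj, of s t] that xy
      by (auto simp: k_def dist_real_def algebra_simps)
    have "\<exists>T\<in>sets lebesgue. ?A \<inter> {x<..<y} \<subseteq> T \<and> emeasure lebesgue T \<le> ennreal ((k y - k x) / (2 * r))"
    proof (rule vitali_growth[where k = k and x = x and y = y])
      fix s t assume "x \<le> s" "s \<le> t" "t \<le> y"
      moreover have "0 \<le> \<bar>f t - f s\<bar> - \<sigma> * (f t - f s)"
        by (auto simp: \<sigma>_def)
      ultimately show "k s \<le> k t" using inc[of s t] by linarith
    next
      fix t d :: real assume t: "t \<in> ?A \<inter> {x<..<y}" and "0 < d"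
      \<comment> \<open>Slopes of both signs occur at \<open>t\<close>, so those opposite to
        \<open>\<sigma>\<close> can be selected.\<close>
      have slope: "\<exists>\<^sub>F s in at t. \<sigma> * ((f s - f t) / (s - t)) < - r"
      proof -
        have slope_eq: "(f s - f t) / (s - t) = (l s - l t) / (s - t) - \<gamma>" if "s \<noteq> t" for s
          using that by (simp add: f_def field_simps)
        have "\<forall>\<^sub>F s in at t. s \<noteq> t" by (simp add: eventually_at_filter)
        show ?thesis
        proof (cases "f x \<le> f y")
          case True
          have "\<exists>\<^sub>F s in at t. (l s - l t) / (s - t) < \<alpha>" using t by simp
          then have "\<exists>\<^sub>F s in at t. (l s - l t) / (s - t) < \<alpha> \<and> s \<noteq> t"
            using \<open>\<forall>\<^sub>F s in at t. s \<noteq> t\<close> by (rule frequently_eventually_frequently)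
          then show ?thesis
            by (rule frequently_elim1) (use True in \<open>auto simp: slope_eq r \<sigma>_def\<close>)
        next
          case False
          have "\<exists>\<^sub>F s in at t. \<beta> < (l s - l t) / (s - t)" using t by simp
          then have "\<exists>\<^sub>F s in at t. \<beta> < (l s - l t) / (s - t) \<and> s \<noteq> t"
            using \<open>\<forall>\<^sub>F s in at t. s \<noteq> t\<close> by (rule frequently_eventually_frequently)
          then show ?thesis
            by (rule frequently_elim1) (use False in \<open>auto simp: slope_eq r \<sigma>_def\<close>)
        qed
      qed
      obtain s where s: "\<sigma> * ((f s - f t) / (s - t)) < - r" "s \<noteq> t" "x < s" "s < y" "\<bar>s - t\<bar> < d"
        using frequently_at_real[OF slope, of x y d] t \<open>0 < d\<close> by auto
      define p q where "p = min s t" and "q = max s t"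
      have pq: "x \<le> p" "p < q" "q \<le> y" "p \<le> t" "t \<le> q" "q - p < d"
        using s t by (auto simp: p_def q_def)
      have "(f s - f t) / (s - t) = (f q - f p) / (q - p)"
      proof (cases "s \<le> t")
        case True
        then show ?thesis using s(2) by (simp add: p_def q_def divide_simps) (simp add: algebra_simps)
      next
        case False
        then show ?thesis by (simp add: p_def q_def)
      qed
      with s(1) have "\<sigma> * ((f q - f p) / (q - p)) < - r" by simp
      then have "\<sigma> * (f q - f p) < - r * (q - p)"
        using pq by (simp add: field_simps)
      moreover from this have "r * (q - p) \<le> \<bar>f q - f p\<bar>"
        by (auto simp: \<sigma>_def split: if_splits)
      ultimately have "2 * r * (q - p) \<le> k q - k p"
        using inc[of p q] pq by (simp add: algebra_simps)
      with pq show "\<exists>p q. x \<le> p \<and> p < q \<and> q \<le> y \<and> p \<le> t \<and> t \<le> q \<and> q - p < d \<and> 2 * r * (q - p) \<le> k q - k p"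
        by blast
    qed (use xy r in auto)
    then show "\<exists>T\<in>sets lebesgue. ?A \<inter> {x<..<y} \<subseteq> T \<and>
        emeasure lebesgue T \<le> ennreal ((w y - w x - dist (f x) (f y)) / (2 * r))"
      by (simp add: k_def \<sigma> algebra_simps)
  qed (use r True in auto)
  then show ?thesis .
qed simp

text \<open>Slopes above \<open>n\<close> at arbitrarily small scales confine the set to outer
  measure at most \<open>(l b - l a) / n\<close>, for every positive \<open>n\<close>.\<close>

lemma mono_slope_unbounded_negligible:
  fixes l :: "real \<Rightarrow> real"
  assumes mono: "\<And>s t. a \<le> s \<Longrightarrow> s \<le> t \<Longrightarrow> t \<le> b \<Longrightarrow> l s \<le> l t"
  shows "negligible {t\<in>{a<..<b}. \<forall>n::nat. \<exists>\<^sub>F s in at t. real n < (l s - l t) / (s - t)}"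
    (is "negligible ?A")
proof (cases "a < b")
  case True
  have outer: "\<exists>T\<in>sets lebesgue. ?A \<subseteq> T \<and> emeasure lebesgue T \<le> ennreal ((l b - l a) / n)"
    if n: "0 < n" for n :: nat
  proof (rule vitali_growth[where k = l and x = a and y = b])
    fix t d :: real assume t: "t \<in> ?A" and "0 < d"
    then have "\<exists>\<^sub>F s in at t. real n < (l s - l t) / (s - t)" by simp
    then obtain s where s: "n < (l s - l t) / (s - t)" "s \<noteq> t" "a < s" "s < b" "\<bar>s - t\<bar> < d"
      using frequently_at_real[of _ t a b d] t \<open>0 < d\<close> by auto
    define p q where "p = min s t" and "q = max s t"
    have pq: "a \<le> p" "p < q" "q \<le> b" "p \<le> t" "t \<le> q" "q - p < d"
      using s t by (auto simp: p_def q_def)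
    have "(l s - l t) / (s - t) = (l q - l p) / (q - p)"
    proof (cases "s \<le> t")
      case True
      then show ?thesis using s(2) by (simp add: p_def q_def divide_simps) (simp add: algebra_simps)
    next
      case False
      then show ?thesis by (simp add: p_def q_def)
    qed
    with s(1) have "n < (l q - l p) / (q - p)" by simp
    then have "n * (q - p) \<le> l q - l p" using pq by (simp add: field_simps)
    with pq show "\<exists>p q::real. a \<le> p \<and> p < q \<and> q \<le> b \<and> p \<le> t \<and> t \<le> q \<and> q - p < d \<and> real n * (q - p) \<le> l q - l p"
      by blast
  qed (use True n mono in auto)
  show ?thesis
  proof -
    have small: "outer_measure_of lebesgue ?A \<le> ennreal e" if "0 < e" for e
    proof -
      have "0 \<le> l b - l a" using mono[of a b] True by simp
      obtain n :: nat where n: "0 < n" "(l b - l a) / n \<le> e"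
      proof -
        obtain n :: nat where "(l b - l a) / e < n" using reals_Archimedean2 by blast
        moreover have "0 \<le> (l b - l a) / e" using \<open>0 \<le> l b - l a\<close> \<open>0 < e\<close> by simp
        ultimately have "0 < real n" by linarith
        then have "0 < n" "(l b - l a) / n \<le> e"
          using \<open>(l b - l a) / e < n\<close> \<open>0 < e\<close> by (auto simp: field_simps)
        then show thesis by (rule that)
      qed
      obtain T where T: "T \<in> sets lebesgue" "?A \<subseteq> T" "emeasure lebesgue T \<le> ennreal ((l b - l a) / n)"
        using outer[OF n(1)] by blast
      have "outer_measure_of lebesgue ?A \<le> outer_measure_of lebesgue T"
        using T(2) by (rule outer_measure_of_mono)
      also have "\<dots> = emeasure lebesgue T" using T(1) by (rule outer_measure_of_eq)
      also have "\<dots> \<le> ennreal e" using T(3) n(2) by (meson ennreal_leI order_trans)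
      finally show ?thesis .
    qed
    have "outer_measure_of lebesgue ?A \<le> 0"
    proof (rule ennreal_le_epsilon)
      fix e :: real assume "0 < e"
      from small[OF this] show "outer_measure_of lebesgue ?A \<le> 0 + ennreal e" by simp
    qed
    then obtain B where "B \<in> sets lebesgue" "?A \<subseteq> B" "emeasure lebesgue B = 0"
      using outer_measure_of_attain[of ?A lebesgue] by auto
    then show ?thesis
      by (meson negligible_iff_null_sets negligible_subset null_setsI)
  qed
qed simp

text \<open>Without a limit, \<open>Liminf\<close> and \<open>Limsup\<close> would be separated by
  two rationals; the bounds exclude an infinite limit. Rational thresholds keep the family of
  exceptional sets countable in the application to slopes.\<close>

lemma tendsto_if_no_slope_gap:
  fixes q :: "'b \<Rightarrow> real"
  assumes F: "F \<noteq> bot"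
    and gap: "\<And>\<alpha> \<beta>. \<alpha> \<in> \<rat> \<Longrightarrow> \<beta> \<in> \<rat> \<Longrightarrow> \<alpha> < \<beta> \<Longrightarrow> \<not> ((\<exists>\<^sub>F s in F. q s < \<alpha>) \<and> (\<exists>\<^sub>F s in F. \<beta> < q s))"
    and upper: "\<forall>\<^sub>F s in F. q s \<le> C" and lower: "\<forall>\<^sub>F s in F. D \<le> q s"
  shows "\<exists>L. (q \<longlongrightarrow> L) F"
proof -
  define Q where "Q s = ereal (q s)" for s
  have "Limsup F Q \<le> Liminf F Q"
  proof (rule ccontr)
    assume "\<not> ?thesis"
    then have "Liminf F Q < Limsup F Q" by simp
    then obtain x where "Liminf F Q < ereal x" "ereal x < Limsup F Q" using ereal_dense2 by blast
    then obtain y where "Liminf F Q < ereal x" "ereal x < ereal y" "ereal y < Limsup F Q"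
      using ereal_dense2 by blast
    then have xy: "Liminf F Q < ereal x" "x < y" "ereal y < Limsup F Q" by auto
    obtain \<alpha> where \<alpha>: "\<alpha> \<in> \<rat>" "x < \<alpha>" "\<alpha> < y" using Rats_dense_in_real[OF xy(2)] by blast
    obtain \<beta> where \<beta>: "\<beta> \<in> \<rat>" "\<alpha> < \<beta>" "\<beta> < y" using Rats_dense_in_real[OF \<alpha>(3)] by blast
    have "\<exists>\<^sub>F s in F. q s < \<alpha>"
    proof (rule ccontr)
      assume "\<not> ?thesis"
      then have "\<forall>\<^sub>F s in F. ereal \<alpha> \<le> Q s" by (simp add: not_frequently Q_def not_less)
      then have "ereal \<alpha> \<le> Liminf F Q" by (rule Liminf_bounded)
      then show False using xy \<alpha> by (meson ereal_less_eq(3) leD less_imp_le order_trans less_le_trans)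
    qed
    moreover have "\<exists>\<^sub>F s in F. \<beta> < q s"
    proof (rule ccontr)
      assume "\<not> ?thesis"
      then have "\<forall>\<^sub>F s in F. Q s \<le> ereal \<beta>" by (simp add: not_frequently Q_def not_less)
      then have "Limsup F Q \<le> ereal \<beta>" by (rule Limsup_bounded)
      then show False using xy \<beta> by (meson ereal_less_eq(3) leD less_imp_le order_trans less_le_trans)
    qed
    ultimately show False using gap[OF \<alpha>(1) \<beta>(1) \<beta>(2)] by blast
  qed
  with Liminf_le_Limsup[OF F, of Q] have eq: "Liminf F Q = Limsup F Q" by simp
  then have lim: "(Q \<longlongrightarrow> Limsup F Q) F" by (intro Liminf_eq_Limsup F) auto
  have "Limsup F Q \<le> ereal C" using upper by (intro Limsup_bounded) (auto simp: Q_def)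
  moreover have "ereal D \<le> Liminf F Q" using lower by (intro Liminf_bounded) (auto simp: Q_def)
  ultimately obtain L where "Limsup F Q = ereal L" using eq by (cases "Limsup F Q") auto
  with lim have "((\<lambda>s. ereal (q s)) \<longlongrightarrow> ereal L) F" by (simp add: Q_def[abs_def])
  then have "(q \<longlongrightarrow> L) F" by simp
  then show ?thesis by blast
qed

text \<open>Almost everywhere the metric derivative is the ordinary derivative of the variation
  function \<open>l\<close>. The exceptional points are those where the slopes of \<open>l\<close>
  and \<open>f\<close> keep differing by more than \<open>c\<close> (\<open>A1 c\<close>), where the
  slope of \<open>l\<close> oscillates (\<open>A2\<close>), and where it is unbounded
  (\<open>A3\<close>).\<close>

theorem metric_derivative_exists_ae:
  fixes f :: "real \<Rightarrow> 'a::metric_space"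
  assumes M: "monotone_majorant f a b M"
  shows "negligible {t\<in>{a<..<b}. \<nexists>L. ((\<lambda>s. dist (f s) (f t) / \<bar>s - t\<bar>) \<longlongrightarrow> L) (at t)}"
proof (cases "a < b")
  case True
  then obtain l where l: "minimal_majorant f a b l"
    using minimal_majorant_exists[OF M] by auto
  then have maj: "monotone_majorant f a b l" by (simp add: minimal_majorant_def)
  note mono = monotone_majorant_mono[OF maj]
  define A1 where "A1 c = {t\<in>{a<..<b}. \<exists>\<^sub>F s in at t. c * \<bar>s - t\<bar> < \<bar>l s - l t\<bar> - dist (f s) (f t)}" for c
  define A2 where "A2 \<alpha> \<beta> = {t\<in>{a<..<b}. (\<exists>\<^sub>F s in at t. (l s - l t) / (s - t) < \<alpha>) \<and>
                                  (\<exists>\<^sub>F s in at t. \<beta> < (l s - l t) / (s - t))}" for \<alpha> \<beta>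
  define A3 where "A3 = {t\<in>{a<..<b}. \<forall>n::nat. \<exists>\<^sub>F s in at t. real n < (l s - l t) / (s - t)}"
  define N where "N = (\<Union>n::nat. A1 (1 / Suc n)) \<union> (\<Union>(\<alpha>, \<beta>)\<in>{(\<alpha>, \<beta>). \<alpha> \<in> \<rat> \<and> \<beta> \<in> \<rat> \<and> \<alpha> < \<beta>}. A2 \<alpha> \<beta>) \<union> A3"
  have "countable {(\<alpha>::real, \<beta>::real). \<alpha> \<in> \<rat> \<and> \<beta> \<in> \<rat> \<and> \<alpha> < \<beta>}"
    by (rule countable_subset[OF _ countable_SIGMA[OF countable_rat countable_rat]]) auto
  moreover have "negligible (A1 (1 / real (Suc n)))" for n
    unfolding A1_def by (intro minimal_majorant_increment_negligible[OF l]) auto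
  moreover have "negligible (A2 \<alpha> \<beta>)" if "\<alpha> < \<beta>" for \<alpha> \<beta>
    unfolding A2_def using that by (intro mono_slope_gap_negligible mono) auto
  moreover have "negligible A3"
    unfolding A3_def by (intro mono_slope_unbounded_negligible mono) auto
  ultimately have "negligible N"
    unfolding N_def by (intro negligible_Un negligible_countable_Union countable_image) auto
  moreover have "\<exists>L. ((\<lambda>s. dist (f s) (f t) / \<bar>s - t\<bar>) \<longlongrightarrow> L) (at t)"
    if t: "a < t" "t < b" "t \<notin> N" for t
  proof -
    define q where "q s = (l s - l t) / (s - t)" for s
    have near: "\<forall>\<^sub>F s in at t. s \<in> {a<..<b} \<and> s \<noteq> t"
      using t eventually_at_in_open[of "{a<..<b}" t] by (simp add: conj_commute)
    have q_abs: "q s = \<bar>l s - l t\<bar> / \<bar>s - t\<bar>" "dist (f s) (f t) \<le> \<bar>l s - l t\<bar>"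
      if st: "s \<in> {a<..<b}" "s \<noteq> t" for s
    proof -
      consider "s < t" | "t < s" using st(2) by linarith
      then have "q s = \<bar>l s - l t\<bar> / \<bar>s - t\<bar> \<and> dist (f s) (f t) \<le> \<bar>l s - l t\<bar>"
      proof cases
        case 1
        have "l s \<le> l t" using mono[of s t] 1 st(1) t(2) by simp
        moreover have "dist (f s) (f t) \<le> l t - l s"
          using monotone_majorantD[OF maj, of s t] 1 st(1) t(2) by simp
        ultimately show ?thesis
          using 1 by (simp add: q_def abs_of_nonpos minus_divide_divide del: minus_diff_eq)
      next
        case 2
        have "l t \<le> l s" using mono[of t s] 2 st(1) t(1) by simp
        moreover have "dist (f s) (f t) \<le> l s - l t"
          using monotone_majorantD[OF maj, of t s] 2 st(1) t(1) by (simp add: dist_commute)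
        ultimately show ?thesis unfolding q_def using 2 by simp
      qed
      then show "q s = \<bar>l s - l t\<bar> / \<bar>s - t\<bar>" "dist (f s) (f t) \<le> \<bar>l s - l t\<bar>" by auto
    qed
    have "\<exists>n. \<not> (\<exists>\<^sub>F s in at t. real n < q s)"
      using t unfolding N_def A3_def q_def by auto
    then obtain n where "\<forall>\<^sub>F s in at t. q s \<le> real n"
      by (auto simp: not_frequently not_less)
    moreover have "\<forall>\<^sub>F s in at t. 0 \<le> q s"
      using near by eventually_elim (use q_abs(1) in auto)
    moreover have "\<not> ((\<exists>\<^sub>F s in at t. q s < \<alpha>) \<and> (\<exists>\<^sub>F s in at t. \<beta> < q s))"
      if "\<alpha> \<in> \<rat>" "\<beta> \<in> \<rat>" "\<alpha> < \<beta>" for \<alpha> \<beta>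
    proof -
      have "t \<notin> A2 \<alpha> \<beta>" using t(3) that unfolding N_def by blast
      then show ?thesis using t(1,2) unfolding A2_def q_def by simp
    qed
    ultimately obtain L where L: "(q \<longlongrightarrow> L) (at t)"
      using tendsto_if_no_slope_gap[of "at t" q "real n" 0] by auto
    have "((\<lambda>s. q s - dist (f s) (f t) / \<bar>s - t\<bar>) \<longlongrightarrow> 0) (at t)"
    proof (rule tendstoI)
      fix e :: real assume "0 < e"
      then obtain n where n: "1 / real (Suc n) < e" using reals_Archimedean[of e] by (auto simp: inverse_eq_divide)
      have "t \<notin> A1 (1 / Suc n)" using t by (auto simp: N_def)
      then have "\<forall>\<^sub>F s in at t. \<bar>l s - l t\<bar> - dist (f s) (f t) \<le> 1 / Suc n * \<bar>s - t\<bar>"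
        using t unfolding A1_def by (auto simp: not_frequently not_less)
      then show "\<forall>\<^sub>F s in at t. dist (q s - dist (f s) (f t) / \<bar>s - t\<bar>) 0 < e"
        using near
      proof eventually_elim
        case (elim s)
        then have "\<bar>s - t\<bar> > 0" by simp
        have "q s - dist (f s) (f t) / \<bar>s - t\<bar> = (\<bar>l s - l t\<bar> - dist (f s) (f t)) / \<bar>s - t\<bar>"
          using elim q_abs(1)[of s] by (simp add: diff_divide_distrib)
        moreover have "(\<bar>l s - l t\<bar> - dist (f s) (f t)) / \<bar>s - t\<bar> \<le> 1 / Suc n"
          using elim(1) \<open>\<bar>s - t\<bar> > 0\<close> by (subst pos_divide_le_eq) auto
        moreover have "0 \<le> (\<bar>l s - l t\<bar> - dist (f s) (f t)) / \<bar>s - t\<bar>"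
          using elim(2) q_abs(2)[of s] by simp
        ultimately have "\<bar>q s - dist (f s) (f t) / \<bar>s - t\<bar>\<bar> \<le> 1 / Suc n"
          by (simp only: abs_of_nonneg)
        then show ?case
          using n unfolding dist_real_def diff_0_right by (rule le_less_trans)
      qed
    qed
    from tendsto_diff[OF L this] have "((\<lambda>s. dist (f s) (f t) / \<bar>s - t\<bar>) \<longlongrightarrow> L) (at t)" by simp
    then show ?thesis by blast
  qed
  ultimately show ?thesis
    by (elim negligible_subset) auto
qed simp

subsection \<open>Almost everywhere bounds on slopes\<close>

text \<open>If the derivative at \<open>t\<close> is nonzero, the distance of \<open>h s\<close>
  from \<open>h t\<close> is at least a fixed multiple of that of \<open>s\<close> from
  \<open>t\<close> for \<open>s\<close> near \<open>t\<close>. On short cells of the points that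
  share scale and multiple, \<open>h\<close> is injective with Lipschitz inverse, so each piece is a
  Lipschitz image of a subset of \<open>N\<close>.\<close>

lemma negligible_preimage_nonzero_derivative:
  fixes h :: "real \<Rightarrow> real"
  assumes N: "negligible N"
  shows "negligible {t. h t \<in> N \<and> (\<exists>D. D \<noteq> 0 \<and> (h has_real_derivative D) (at t))}"
    (is "negligible ?A")
proof -
  \<comment> \<open>The index \<open>n\<close> gives both the radius of comparison
    \<open>1 / Suc n\<close> and the Lipschitz constant \<open>Suc n\<close> of the inverse.
    Half-open cells of width \<open>1 / Suc n\<close> keep any two of their points strictly within
    that radius.\<close>
  define A where "A n = {t. h t \<in> N \<and> (\<forall>s. \<bar>s - t\<bar> < 1 / Suc n \<longrightarrow> \<bar>s - t\<bar> \<le> Suc n * \<bar>h s - h t\<bar>)}" for n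
  define P where "P n k = A n \<inter> {of_int k / Suc n ..< (of_int k + 1) / Suc n}" for n and k :: int
  have "negligible (P n k)" for n k
  proof -
    have lip: "\<bar>s - t\<bar> \<le> Suc n * \<bar>h s - h t\<bar>" if "s \<in> P n k" "t \<in> P n k" for s t
    proof -
      have "\<bar>s - t\<bar> < (of_int k + 1) / Suc n - of_int k / Suc n"
        using that unfolding P_def by auto
      then have "\<bar>s - t\<bar> < 1 / Suc n" by (simp add: diff_divide_distrib[symmetric])
      then show ?thesis using that(2) unfolding P_def A_def by blast
    qed
    have inj: "inj_on h (P n k)"
      by (rule inj_onI) (use lip in force)
    define f where "f = inv_into (P n k) h"
    have "negligible (f ` h ` P n k)"
    proof (rule negligible_locally_Lipschitz_image)
      show "negligible (h ` P n k)"
        by (rule negligible_subset[OF N]) (auto simp: P_def A_def)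
      fix x assume x: "x \<in> h ` P n k"
      show "\<exists>T B. open T \<and> x \<in> T \<and> (\<forall>y\<in>h ` P n k \<inter> T. norm (f y - f x) \<le> B * norm (y - x))"
        using x inj by (intro exI[of _ UNIV] exI[of _ "real (Suc n)"]) (auto simp: f_def lip simp del: of_nat_Suc)
    qed simp
    moreover have "f ` h ` P n k = P n k"
      using inj unfolding f_def by (simp add: image_image)
    ultimately show ?thesis by simp
  qed
  then have "negligible (\<Union>n. \<Union>k. P n k)"
    by (intro negligible_countable_Union) auto
  moreover have "?A \<subseteq> (\<Union>n. \<Union>k. P n k)"
  proof
    fix t assume "t \<in> ?A"
    then obtain D where D: "h t \<in> N" "D \<noteq> 0" "(h has_real_derivative D) (at t)" by auto
    have "((\<lambda>s. \<bar>(h s - h t) / (s - t)\<bar>) \<longlongrightarrow> \<bar>D\<bar>) (at t)"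
      using D(3) by (intro tendsto_rabs) (simp add: has_field_derivative_iff)
    then have "\<forall>\<^sub>F s in at t. \<bar>D\<bar> / 2 < \<bar>(h s - h t) / (s - t)\<bar>"
      by (rule order_tendstoD) (use D in auto)
    then obtain d where d: "d > 0" "\<And>s. s \<noteq> t \<Longrightarrow> \<bar>s - t\<bar> < d \<Longrightarrow> \<bar>D\<bar> / 2 < \<bar>(h s - h t) / (s - t)\<bar>"
      by (auto simp: eventually_at dist_real_def)
    obtain n1 :: nat where n1: "inverse (Suc n1) < d" using reals_Archimedean[OF d(1)] by auto
    obtain n2 :: nat where n2: "inverse (Suc n2) < \<bar>D\<bar> / 2" using reals_Archimedean[of "\<bar>D\<bar> / 2"] D by auto
    define n where "n = max n1 n2"
    have n: "1 / Suc n < d" "1 / Suc n < \<bar>D\<bar> / 2"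
    proof -
      have "inverse (real (Suc n)) \<le> inverse (Suc n1)" "inverse (real (Suc n)) \<le> inverse (Suc n2)"
        by (intro le_imp_inverse_le; simp add: n_def)+
      then show "1 / Suc n < d" "1 / Suc n < \<bar>D\<bar> / 2"
        using n1 n2 by (auto simp only: inverse_eq_divide)
    qed
    have "\<bar>s - t\<bar> \<le> Suc n * \<bar>h s - h t\<bar>" if "\<bar>s - t\<bar> < 1 / Suc n" for s
    proof (cases "s = t")
      case False
      then have pos: "0 < \<bar>s - t\<bar>" by simp
      have "\<bar>s - t\<bar> < d" using that n(1) by linarith
      then have "\<bar>D\<bar> / 2 < \<bar>h s - h t\<bar> / \<bar>s - t\<bar>"
        using d(2)[OF False] by (simp only: abs_divide)
      then have "1 / Suc n < \<bar>h s - h t\<bar> / \<bar>s - t\<bar>"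
        using n(2) by linarith
      then show ?thesis using pos by (simp add: field_simps)
    qed simp
    then have "t \<in> A n" using D by (simp add: A_def)
    moreover have "t \<in> {of_int \<lfloor>t * Suc n\<rfloor> / Suc n ..< (of_int \<lfloor>t * Suc n\<rfloor> + 1) / Suc n}"
      by (simp add: pos_divide_le_eq pos_less_divide_eq del: of_nat_Suc)
    ultimately show "t \<in> (\<Union>n. \<Union>k. P n k)" unfolding P_def by blast
  qed
  ultimately show ?thesis by (rule negligible_subset)
qed

section \<open>Curves and functions controlled by an integral\<close>

lemma negligible_imp_AE_lborel:
  assumes "negligible N"
  shows "AE x in lborel. x \<notin> N"
proof -
  have "AE x in lebesgue. x \<notin> N"
    using assms by (intro AE_not_in) (simp add: negligible_iff_null_sets)
  then show ?thesis by (simp add: AE_completion_iff)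
qed

lemma set_lebesgue_integral_Icc_diff:
  fixes m :: "real \<Rightarrow> real"
  assumes m: "set_integrable lborel {a..b} m" and st: "a \<le> s" "s \<le> t" "t \<le> b"
  shows "(LINT r:{s..t}|lborel. m r) = integral {a..t} m - integral {a..s} m"
proof -
  have "set_integrable lborel {s..t} m"
    by (rule set_integrable_subset[OF m]) (use st in auto)
  then have "(LINT r:{s..t}|lborel. m r) = integral {s..t} m"
    by (rule set_borel_integral_eq_integral)
  moreover have "m integrable_on {a..t}"
    by (rule integrable_on_subinterval[OF set_borel_integral_eq_integral(1)[OF m]]) (use st in auto)
  ultimately show ?thesis
    using Henstock_Kurzweil_Integration.integral_combine[of a s t m] st by simp
qed

text \<open>This ties \<open>metric_derivative\<close> to a genuine limit. Since \<open>m\<close> is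
  integrable only on compact parts of the open half-line, the half-line is exhausted by intervals
  from \<open>1 / Suc n\<close> to \<open>Suc n\<close>, on each of which the integral of
  \<open>m\<close> is a majorant.\<close>

lemma AC_loc_metric_derivative:
  fixes v :: "real \<Rightarrow> 'a::metric_space"
  assumes "AC_loc 0 \<infinity> v"
  shows "AE t in lborel. 0 < t \<longrightarrow>
    ((\<lambda>s. dist (v s) (v t) / \<bar>s - t\<bar>) \<longlongrightarrow> metric_derivative v t) (at t)"
proof -
  obtain m where m: "L1_loc 0 \<infinity> m"
      "\<And>s t. 0 < s \<Longrightarrow> s \<le> t \<Longrightarrow> dist (v s) (v t) \<le> (LINT r:{s..t}|lborel. m r)"
    using assms unfolding AC_loc_def by auto
  have "AE t in lborel. \<forall>n::nat. t \<notin> {t\<in>{1 / Suc n<..<real (Suc n)}.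
      \<nexists>L. ((\<lambda>s. dist (v s) (v t) / \<bar>s - t\<bar>) \<longlongrightarrow> L) (at t)}"
    unfolding AE_all_countable
  proof (intro allI negligible_imp_AE_lborel metric_derivative_exists_ae)
    fix n :: nat
    have int: "set_integrable lborel {1 / Suc n..real (Suc n)} m"
    proof (cases "1 / Suc n \<le> real (Suc n)")
      case True
      then show ?thesis using m(1) by (auto simp: L1_loc_def)
    qed simp
    show "monotone_majorant v (1 / Suc n) (Suc n) (\<lambda>t. integral {1 / Suc n..t} m)"
      unfolding monotone_majorant_def
    proof (intro allI impI)
      fix s t assume st: "1 / Suc n \<le> s" "s \<le> t" "t \<le> real (Suc n)"
      have "0 < 1 / real (Suc n)" by simp
      then have "0 < s" using st(1) by linarith
      then show "dist (v s) (v t) \<le> integral {1 / Suc n..t} m - integral {1 / Suc n..s} m"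
        using m(2)[of s t] st set_lebesgue_integral_Icc_diff[OF int st] by simp
    qed
  qed
  then show ?thesis
  proof eventually_elim
    case (elim t)
    show ?case
    proof
      assume "0 < t"
      obtain n1 :: nat where n1: "inverse (Suc n1) < t" using reals_Archimedean[OF \<open>0 < t\<close>] by auto
      obtain n2 :: nat where n2: "t < n2" using reals_Archimedean2 by blast
      define n where "n = max n1 n2"
      have "inverse (real (Suc n)) \<le> inverse (Suc n1)"
        by (intro le_imp_inverse_le; simp add: n_def)
      then have "t \<in> {1 / Suc n<..<real (Suc n)}"
        using n1 n2 by (auto simp: n_def inverse_eq_divide)
      with elim obtain L where "((\<lambda>s. dist (v s) (v t) / \<bar>s - t\<bar>) \<longlongrightarrow> L) (at t)" by blast
      moreover from this have "metric_derivative v t = L"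
        unfolding metric_derivative_def by (intro tendsto_Lim) auto
      ultimately show "((\<lambda>s. dist (v s) (v t) / \<bar>s - t\<bar>) \<longlongrightarrow> metric_derivative v t) (at t)"
        by simp
    qed
  qed
qed

lemma AC_loc_continuous_on:
  fixes v :: "real \<Rightarrow> 'a::metric_space"
  assumes "AC_loc 0 \<infinity> v"
  shows "continuous_on {0<..} v"
proof -
  obtain m where m: "L1_loc 0 \<infinity> m"
      "\<And>s t. 0 < s \<Longrightarrow> s \<le> t \<Longrightarrow> dist (v s) (v t) \<le> (LINT r:{s..t}|lborel. m r)"
    using assms unfolding AC_loc_def by auto
  have "isCont v t" if "0 < t" for t
  proof -
    define J where "J x = integral {t / 2..x} m" for x
    have int: "set_integrable lborel {t / 2..t + 1} m"
      using m(1) that by (simp add: L1_loc_def)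
    have "continuous_on {t / 2..t + 1} J"
      unfolding J_def by (intro indefinite_integral_continuous_1 set_borel_integral_eq_integral(1) int)
    then have "isCont J t"
      by (rule continuous_on_interior) (use that in simp)
    then have J: "((\<lambda>x. \<bar>J x - J t\<bar>) \<longlongrightarrow> 0) (at t)"
      by (intro tendsto_rabs_zero) (simp add: isCont_def LIM_zero)
    have "\<forall>\<^sub>F x in at t. x \<in> {t / 2<..<t + 1}"
      using that by (intro eventually_at_in_open') auto
    then have "\<forall>\<^sub>F x in at t. dist (v x) (v t) \<le> \<bar>J x - J t\<bar>"
    proof eventually_elim
      case (elim x)
      show ?case
      proof (cases "x \<le> t")
        case True
        then have "dist (v x) (v t) \<le> J t - J x"
          using m(2)[of x t] set_lebesgue_integral_Icc_diff[OF int, of x t] elim that by (simp add: J_def)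
        then show ?thesis by linarith
      next
        case False
        then have "dist (v x) (v t) \<le> J x - J t"
          using m(2)[of t x] set_lebesgue_integral_Icc_diff[OF int, of t x] elim that
          by (simp add: J_def dist_commute)
        then show ?thesis by linarith
      qed
    qed
    then have "((\<lambda>x. dist (v x) (v t)) \<longlongrightarrow> 0) (at t)"
      by (intro tendsto_sandwich[OF _ _ tendsto_const J]) auto
    then show ?thesis unfolding isCont_def by (rule tendsto_dist_iff[THEN iffD2])
  qed
  then show ?thesis by (intro continuous_at_imp_continuous_on) auto
qed

text \<open>
  The exceptional null set is covered by an open set \<open>O\<close> on which \<open>m\<close> has small integral \<open>\<eta>\<close>;
  then \<open>G t - \<eta> (t - a)\<close> minus the integral of \<open>m\<close> over \<open>O \<inter> {a<..t}\<close> cannot become positive.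
\<close>

lemma nonincreasing_if_right_slope_ae:
  fixes G m :: "real \<Rightarrow> real"
  assumes "a \<le> b" and m: "set_integrable lborel {a..b} m"
    and incr: "\<And>s t. a \<le> s \<Longrightarrow> s \<le> t \<Longrightarrow> t \<le> b \<Longrightarrow> G t - G s \<le> (LINT r:{s..t}|lborel. m r)"
    and slope: "AE t in lborel. a < t \<and> t < b \<longrightarrow>
      (\<forall>\<eta>>0. \<forall>\<^sub>F s in at_right t. G s \<le> G t + \<eta> * (s - t))"
  shows "G b \<le> G a"
proof -
  \<comment> \<open>The absolute value of \<open>m\<close> is the density of a finite measure
    \<open>M\<close>, absolutely continuous with respect to Lebesgue measure; outer regularity of
    \<open>M\<close> then provides the open cover.\<close>
  define f where "f r = \<bar>indicator {a..b} r *\<^sub>R m r\<bar>" for r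
  have f: "integrable lborel f" "\<And>r. 0 \<le> f r"
    using m by (auto simp: f_def[abs_def] set_integrable_def)
  define M where "M = density lborel (\<lambda>r. ennreal (f r))"
  have [measurable]: "f \<in> borel_measurable borel" using f(1) by auto
  have sets_M: "sets M = sets borel" by (simp add: M_def)
  have fin: "emeasure M (space M) \<noteq> \<infinity>"
    using integrableD(2)[OF f(1)] f(2) by (simp add: M_def emeasure_density)
  interpret finite_measure M by (rule finite_measureI[OF fin])
  have measure_Icc: "measure M {s..t} = (LINT r:{s..t}|lborel. f r)" for s t
    unfolding set_lebesgue_integral_def
    by (subst integral_eq_nn_integral)
       (use f in \<open>auto simp: M_def measure_def emeasure_density intro!: arg_cong[where f = enn2real]
          nn_integral_cong simp: indicator_def\<close>)
  have null: "emeasure M X = 0" if "X \<in> null_sets lborel" for X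
    using absolutely_continuousI_density[of "\<lambda>r. ennreal (f r)" lborel] that
    by (auto simp: M_def absolutely_continuous_def)
  have measure_Ioc: "measure M {s<..t} = (LINT r:{s..t}|lborel. f r)" if "s \<le> t" for s t
  proof -
    have "measure M ({s} \<union> {s<..t}) = measure M {s} + measure M {s<..t}"
      by (intro finite_measure_Union) (auto simp: sets_M)
    moreover have "{s} \<union> {s<..t} = {s..t}" using that by auto
    moreover have "measure M {s} = 0" using null[OF countable_imp_null_set_lborel[of "{s}"]] by (simp add: measure_def)
    ultimately show ?thesis by (simp add: measure_Icc)
  qed
  have incr_f: "G t - G s \<le> measure M {s<..t}" if "a \<le> s" "s \<le> t" "t \<le> b" for s t
  proof -
    have "G t - G s \<le> (LINT r:{s..t}|lborel. m r)" by (rule incr[OF that])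
    also have "\<dots> \<le> (LINT r:{s..t}|lborel. f r)"
      unfolding set_lebesgue_integral_def
    proof (rule integral_mono)
      show "integrable lborel (\<lambda>x. indicator {s..t} x *\<^sub>R m x)"
        using set_integrable_subset[OF m, of "{s..t}"] that by (auto simp: set_integrable_def)
      show "integrable lborel (\<lambda>x. indicator {s..t} x *\<^sub>R f x)"
        using f(1) integrable_mult_indicator[of "{s..t}" lborel f] by simp
    qed (use that in \<open>auto simp: f_def indicator_def\<close>)
    finally show ?thesis using measure_Ioc that by simp
  qed
  have approx: "G b \<le> G a + \<eta> * (b - a) + \<eta>" if "0 < \<eta>" for \<eta>
  proof -
    define N where "N = {t. \<not> (a < t \<and> t < b \<longrightarrow>
      (\<forall>\<eta>>0. \<forall>\<^sub>F s in at_right t. G s \<le> G t + \<eta> * (s - t)))}"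
    obtain N' where N': "N \<subseteq> N'" "N' \<in> sets borel" "emeasure lborel N' = 0"
      by (rule AE_E[OF slope]) (auto simp: N_def)
    \<comment> \<open>The point \<open>a\<close> is covered too, since the slope assumption speaks
      only of \<open>a < t\<close>.\<close>
    have "N' \<union> {a} \<in> null_sets lborel"
      using N' by (intro null_sets.Un) auto
    then have "emeasure M (N' \<union> {a}) = 0" by (rule null)
    moreover have "emeasure M (N' \<union> {a}) = (INF U\<in>{U. N' \<union> {a} \<subseteq> U \<and> open U}. emeasure M U)"
      using N' by (intro outer_regular sets_M fin) auto
    ultimately have "(INF U\<in>{U. N' \<union> {a} \<subseteq> U \<and> open U}. emeasure M U) < ennreal \<eta>"
      using \<open>0 < \<eta>\<close> by simp
    then obtain U where U: "N' \<union> {a} \<subseteq> U" "open U" "emeasure M U < ennreal \<eta>"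
      by (auto simp: INF_less_iff)
    then have U_small: "measure M U \<le> \<eta>"
      using \<open>0 < \<eta>\<close> by (simp add: emeasure_eq_measure ennreal_less_iff)
    have [measurable]: "U \<in> sets M" using U(2) sets_M by auto
    have Ioc [measurable]: "{s<..t} \<in> sets M" for s t :: real using sets_M by auto
    define \<Psi> where "\<Psi> t = G t - G a - \<eta> * (t - a) - measure M (U \<inter> {a<..t})" for t
    define X where "X = {t\<in>{a..b}. \<Psi> t \<le> 0}"
    define T where "T = Sup X"
    have "a \<in> X" using \<open>a \<le> b\<close> by (simp add: X_def \<Psi>_def)
    have bdd: "bdd_above X" by (rule bdd_aboveI[of _ b]) (auto simp: X_def)
    have T: "a \<le> T" "T \<le> b" unfolding T_def
      using \<open>a \<in> X\<close> bdd by (auto intro: cSup_upper cSup_least simp: X_def)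
    \<comment> \<open>\<open>\<Psi>\<close> cannot jump up, because upward increments of
      \<open>G\<close> are bounded by an absolutely continuous measure; so nonpositivity passes from
      points of \<open>X\<close> to their supremum.\<close>
    have "\<Psi> T \<le> 0"
    proof (rule ccontr)
      assume "\<not> \<Psi> T \<le> 0"
      define J where "J t = integral {a..t} f" for t
      have f_ab: "set_integrable lborel {a..b} f"
        using f(1) integrable_mult_indicator[of "{a..b}" lborel f] by (simp add: set_integrable_def)
      have "continuous_on {a..b} J"
        unfolding J_def by (intro indefinite_integral_continuous_1 set_borel_integral_eq_integral(1) f_ab)
      then obtain d where d: "d > 0" "\<And>t. t \<in> {a..b} \<Longrightarrow> dist t T < d \<Longrightarrow> dist (J t) (J T) < \<Psi> T"
        using T \<open>\<not> \<Psi> T \<le> 0\<close> unfolding continuous_on_iff by (metis atLeastAtMost_iff not_le)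
      obtain t where t: "t \<in> X" "T - d < t"
        using less_cSupD[of X "T - d"] \<open>a \<in> X\<close> d(1) by (auto simp: T_def)
      have "t \<le> T" unfolding T_def by (rule cSup_upper[OF t(1) bdd])
      have t': "a \<le> t" "t \<le> b" "\<Psi> t \<le> 0" using t by (auto simp: X_def)
      have "G T - G t \<le> measure M {t<..T}" using incr_f t' \<open>t \<le> T\<close> T by simp
      also have "\<dots> = J T - J t"
        using measure_Ioc[OF \<open>t \<le> T\<close>] set_lebesgue_integral_Icc_diff[OF f_ab t'(1) \<open>t \<le> T\<close> T(2)]
        by (simp add: J_def)
      also have "\<dots> < \<Psi> T"
        using d(2)[of t] t t' \<open>t \<le> T\<close> by (simp add: dist_real_def)
      finally have "G T - G t < \<Psi> T" .
      moreover have "measure M (U \<inter> {a<..t}) \<le> measure M (U \<inter> {a<..T})"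
        using \<open>t \<le> T\<close> by (intro finite_measure_mono) auto
      moreover have "\<eta> * (t - a) \<le> \<eta> * (T - a)" using \<open>0 < \<eta>\<close> \<open>t \<le> T\<close> by simp
      ultimately show False using t'(3) unfolding \<Psi>_def by linarith
    qed
    have "T = b"
    proof (rule ccontr)
      assume "T \<noteq> b"
      then have "T < b" using T by simp
      \<comment> \<open>Just after \<open>T\<close>, growth of \<open>G\<close> is paid for by the
        measure term if \<open>T\<close> is in \<open>U\<close>, and by the linear term
        otherwise.\<close>
      have "\<exists>s. T < s \<and> s \<le> b \<and> \<Psi> s \<le> \<Psi> T"
      proof (cases "T \<in> U")
        case True
        then obtain d where d: "d > 0" "ball T d \<subseteq> U" using U(2) openE by blast
        define s where "s = min b (T + d / 2)"
        have s: "T < s" "s \<le> b" using d \<open>T < b\<close> by (auto simp: s_def)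
        have "{T<..s} \<subseteq> U" using d s by (auto simp: s_def dist_real_def subset_iff)
        then have "U \<inter> {a<..s} = U \<inter> {a<..T} \<union> {T<..s}" using T s by auto
        then have "measure M (U \<inter> {a<..s}) = measure M (U \<inter> {a<..T} \<union> {T<..s})" by simp
        also have "\<dots> = measure M (U \<inter> {a<..T}) + measure M {T<..s}"
          by (intro finite_measure_Union) auto
        finally have "measure M (U \<inter> {a<..s}) = measure M (U \<inter> {a<..T}) + measure M {T<..s}" .
        moreover have "G s - G T \<le> measure M {T<..s}" using incr_f T s by simp
        moreover have "\<eta> * (T - a) \<le> \<eta> * (s - a)" using \<open>0 < \<eta>\<close> s by simp
        ultimately have "\<Psi> s \<le> \<Psi> T" unfolding \<Psi>_def by linarith
        with s show ?thesis by blast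
      next
        case False
        then have "T \<noteq> a" "T \<notin> N" using U N' by auto
        then have "\<forall>\<^sub>F s in at_right T. G s \<le> G T + \<eta> * (s - T)"
          using T \<open>T < b\<close> \<open>0 < \<eta>\<close> by (auto simp: N_def)
        then obtain c where c: "c > T" "\<And>s. T < s \<Longrightarrow> s < c \<Longrightarrow> G s \<le> G T + \<eta> * (s - T)"
          by (auto simp: eventually_at_right[OF \<open>T < b\<close>])
        define s where "s = min b ((T + c) / 2)"
        have s: "T < s" "s \<le> b" "s < c" using c \<open>T < b\<close> by (auto simp: s_def min_def)
        have "measure M (U \<inter> {a<..T}) \<le> measure M (U \<inter> {a<..s})"
          using s by (intro finite_measure_mono) auto
        moreover have "G s \<le> G T + (\<eta> * (s - a) - \<eta> * (T - a))"
          using c(2)[OF s(1,3)] by (simp add: algebra_simps)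
        ultimately have "\<Psi> s \<le> \<Psi> T" unfolding \<Psi>_def by linarith
        with s show ?thesis by blast
      qed
      then obtain s where s: "T < s" "s \<le> b" "\<Psi> s \<le> 0" using \<open>\<Psi> T \<le> 0\<close> by force
      then have "s \<in> X" using T by (simp add: X_def)
      then have "s \<le> T" unfolding T_def by (rule cSup_upper[OF _ bdd])
      with s show False by simp
    qed
    with \<open>\<Psi> T \<le> 0\<close> have "\<Psi> b \<le> 0" by simp
    moreover have "measure M (U \<inter> {a<..b}) \<le> measure M U"
      by (intro finite_measure_mono) auto
    ultimately show ?thesis using U_small unfolding \<Psi>_def by linarith
  qed
  show ?thesis
  proof (rule field_le_epsilon)
    fix e :: real assume "0 < e"
    define \<eta> where "\<eta> = e / (b - a + 1)"
    have "0 < \<eta>" using \<open>0 < e\<close> \<open>a \<le> b\<close> by (simp add: \<eta>_def)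
    then have "G b \<le> G a + \<eta> * (b - a + 1)" using approx[of \<eta>] by (simp add: distrib_left)
    then show "G b \<le> G a + e" using \<open>a \<le> b\<close> by (simp add: \<eta>_def)
  qed
qed

subsection \<open>Gradient flows\<close>

lemma lsc_imp_eventually_gt:
  fixes f :: "'a::topological_space \<Rightarrow> 'b::complete_linorder"
  assumes "lsc f" "c < f x"
  shows "\<forall>\<^sub>F y in nhds x. c < f y"
proof -
  have "c < Liminf (at x) f" using assms by (auto simp: lsc_def intro: less_le_trans)
  then have "\<forall>\<^sub>F y in at x. c < f y" by (rule less_LiminfD)
  then show ?thesis using assms(2) by (auto simp: eventually_at_filter elim: eventually_mono)
qed

text \<open>Any two points of the curve after time \<open>r\<close> are at most \<open>F r\<close>
  minus the infimum of \<open>F\<close> apart, which becomes arbitrarily small. This gives a Cauchy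
  sequence along integer times, and the same bound transfers its limit to all times.\<close>

lemma finite_length_converges:
  fixes v :: "real \<Rightarrow> 'a::complete_space" and F :: "real \<Rightarrow> real"
  assumes len: "\<And>s t. a \<le> s \<Longrightarrow> s \<le> t \<Longrightarrow> dist (v s) (v t) \<le> F s - F t"
    and lower: "\<And>t. a \<le> t \<Longrightarrow> B \<le> F t"
  shows "\<exists>l. (v \<longlongrightarrow> l) at_top"
proof -
  have bdd: "bdd_below (F ` {a..})" using lower by (intro bdd_belowI[of _ B]) auto
  define L where "L = Inf (F ` {a..})"
  have L: "L \<le> F t" if "a \<le> t" for t
    unfolding L_def using that by (intro cInf_lower bdd) auto
  have small: "\<exists>s\<ge>a. F s < L + e" if "0 < e" for e
    using cInf_lessD[of "F ` {a..}" "L + e"] that by (auto simp: L_def)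
  have close: "dist (v s) (v t) < e" if "F r < L + e" "a \<le> r" "r \<le> s" "s \<le> t" for r s t e
    using len[of s t] len[of r s] zero_le_dist[of "v r" "v s"] L[of t] that by linarith
  obtain N0 :: nat where N0: "a \<le> real N0" using real_arch_simple by blast
  have "Cauchy (\<lambda>n. v (real (n + N0)))"
  proof (rule metric_CauchyI)
    fix e :: real assume "0 < e"
    then obtain r where r: "a \<le> r" "F r < L + e" using small by blast
    obtain M :: nat where M: "r \<le> real M" using real_arch_simple by blast
    have "dist (v (real (m + N0))) (v (real (n + N0))) < e" if "M \<le> m" "M \<le> n" for m n
    proof -
      have "r \<le> real (m + N0)" "r \<le> real (n + N0)" using M that by auto
      then show ?thesis
        using close[of r e "real (m + N0)" "real (n + N0)"] close[of r e "real (n + N0)" "real (m + N0)"] r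
        by (cases "m \<le> n") (auto simp: dist_commute)
    qed
    then show "\<exists>M. \<forall>m\<ge>M. \<forall>n\<ge>M. dist (v (real (m + N0))) (v (real (n + N0))) < e" by blast
  qed
  then obtain l where l: "(\<lambda>n. v (real (n + N0))) \<longlonglongrightarrow> l"
    using Cauchy_convergent_iff convergent_def by blast
  have "(v \<longlongrightarrow> l) at_top"
  proof (rule tendstoI)
    fix e :: real assume "0 < e"
    then obtain r where r: "a \<le> r" "F r < L + e / 2" using small[of "e / 2"] by auto
    have "dist (v t) l < e" if "r \<le> t" for t
    proof -
      have "\<forall>\<^sub>F n in sequentially. dist (v (real (n + N0))) l < e / 2"
        using l \<open>0 < e\<close> by (intro tendstoD) auto
      moreover obtain k :: nat where "t \<le> real k" using real_arch_simple by blast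
      ultimately have "\<forall>\<^sub>F n in sequentially. dist (v (real (n + N0))) l < e / 2 \<and> k \<le> n"
        by (intro eventually_conj eventually_ge_at_top)
      then obtain n where "dist (v (real (n + N0))) l < e / 2" "k \<le> n"
        by (auto simp: eventually_sequentially)
      with \<open>t \<le> real k\<close> have n: "dist (v (real (n + N0))) l < e / 2" "t \<le> real (n + N0)" by auto
      have "dist (v t) (v (real (n + N0))) < e / 2" using close r that n by blast
      then show ?thesis using n(1) dist_triangle[of "v t" l "v (real (n + N0))"] by linarith
    qed
    then show "\<forall>\<^sub>F t in at_top. dist (v t) l < e"
      by (auto simp: eventually_at_top_linorder)
  qed
  then show ?thesis by blast
qed

section \<open>Energy and speed along a flow\<close>

lemma p_gradient_flowD:
  assumes "p_gradient_flow p E g v"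
  shows "AC_loc 0 \<infinity> v" "\<And>t. 0 < t \<Longrightarrow> E (v t) < \<infinity>"
    "\<And>s t. 0 < s \<Longrightarrow> s \<le> t \<Longrightarrow> E (v t) \<le> E (v s)"
    "AE t in lborel. 0 < t \<longrightarrow> g (v t) < \<infinity> \<and>
      (\<exists>D. ((\<lambda>s. real_of_ereal (E (v s))) has_real_derivative D) (at t) \<and>
        D \<le> - (1 / (p / (p - 1))) * enn2real (g (v t)) powr (p / (p - 1)) - (1 / p) * metric_derivative v t powr p)"
  using assms unfolding p_gradient_flow_def eff_domain_def Let_def by blast+

lemma p_gradient_flow_real_energy_antimono:
  assumes flow: "p_gradient_flow p E g v" and E: "\<forall>u. E u \<noteq> -\<infinity>" and "0 < s" "s \<le> t"
  shows "real_of_ereal (E (v t)) \<le> real_of_ereal (E (v s))"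
proof -
  have "E (v t) < \<infinity>" "E (v s) < \<infinity>" "E (v t) \<le> E (v s)"
    using p_gradient_flowD(2,3)[OF flow] assms(3,4) by auto
  moreover have "E (v t) \<noteq> -\<infinity>" "E (v s) \<noteq> -\<infinity>" using E by auto
  ultimately show ?thesis by (cases "E (v t)"; cases "E (v s)") auto
qed

lemma eventually_at_right_slope_le:
  fixes f :: "real \<Rightarrow> real"
  assumes "(f has_real_derivative D) (at r)" "D < c"
  shows "\<forall>\<^sub>F s in at_right r. f s - f r \<le> c * (s - r)"
proof -
  have "((\<lambda>s. (f s - f r) / (s - r)) \<longlongrightarrow> D) (at_right r)"
    using assms(1) by (simp add: has_field_derivative_iff filterlim_at_split)
  then have "\<forall>\<^sub>F s in at_right r. (f s - f r) / (s - r) < c"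
    by (rule order_tendstoD) (rule assms(2))
  then show ?thesis
    using eventually_at_right_less
  proof eventually_elim
    case (elim s)
    then show ?case by (simp add: pos_divide_less_eq)
  qed
qed

text \<open>
  Young's inequality bounds \<open>G w\<close> by \<open>- D\<close>, so \<open>1 \<le> c G\<close> gives \<open>w \<le> - c D\<close>, the speed of decrease
  of \<open>\<theta> \<circ> H\<close>.
\<close>

lemma gradient_flow_right_slope:
  fixes v :: "real \<Rightarrow> 'a::metric_space" and H \<theta> :: "real \<Rightarrow> real"
  assumes p: "1 < p" and w: "((\<lambda>s. dist (v s) (v r) / \<bar>s - r\<bar>) \<longlongrightarrow> w) (at r)"
    and H: "(H has_real_derivative D) (at r)"
    and D: "D \<le> - (1 / (p / (p - 1))) * G powr (p / (p - 1)) - (1 / p) * w powr p" and G: "0 \<le> G"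
    and H_anti: "\<forall>\<^sub>F s in at_right r. \<theta> (H s) \<le> \<theta> (H r)"
    and KL: "D = 0 \<or> (\<exists>c>0. (\<theta> has_real_derivative c) (at (H r)) \<and> 1 \<le> c * G)" and \<eta>: "0 < \<eta>"
  shows "\<forall>\<^sub>F s in at_right r. dist (v r) (v s) + \<theta> (H s) \<le> \<theta> (H r) + \<eta> * (s - r)"
proof -
  define q where "q = p / (p - 1)"
  have q: "1 < q" "1 / q + 1 / p = 1" using p by (auto simp: q_def field_simps)
  have w_nonneg: "0 \<le> w"
    by (rule tendsto_lowerbound[OF w]) auto
  have w_right: "((\<lambda>s. dist (v s) (v r) / \<bar>s - r\<bar>) \<longlongrightarrow> w) (at_right r)"
    using w by (simp add: filterlim_at_split)
  have "\<forall>\<^sub>F s in at_right r. dist (v s) (v r) / \<bar>s - r\<bar> < w + \<eta> / 2"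
    by (rule order_tendstoD(2)[OF w_right]) (use \<eta> in auto)
  then have dist_le: "\<forall>\<^sub>F s in at_right r. dist (v r) (v s) \<le> (w + \<eta> / 2) * (s - r)"
    using eventually_at_right_less
  proof eventually_elim
    case (elim s)
    then show ?case by (simp add: pos_divide_less_eq dist_commute)
  qed
  show ?thesis
  proof (cases "D = 0")
    case True
    \<comment> \<open>The energy inequality forces the speed to vanish here, and monotonicity of
      \<open>\<theta> \<circ> H\<close> replaces the chain rule at a point where
      \<open>\<theta>\<close> may fail to be differentiable.\<close>
    have "0 \<le> 1 / q * G powr q" "0 \<le> 1 / p * w powr p" using p q by auto
    with D True have "1 / p * w powr p = 0" unfolding q_def by linarith
    then have "w = 0" using p by auto
    show ?thesis
      using dist_le H_anti eventually_at_right_less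
    proof eventually_elim
      case (elim s)
      then have "\<eta> / 2 * (s - r) \<le> \<eta> * (s - r)" using \<eta> by (intro mult_right_mono) auto
      with elim \<open>w = 0\<close> show ?case by simp
    qed
  next
    case False
    then obtain c where c: "c > 0" "(\<theta> has_real_derivative c) (at (H r))" "1 \<le> c * G"
      using KL by auto
    have "G * w \<le> G powr q / q + w powr p / p"
      using p q G w_nonneg by (intro Youngs_inequality) auto
    also have "\<dots> \<le> - D" using D by (simp add: q_def mult.commute)
    finally have "G * w \<le> - D" .
    have "w \<le> (c * G) * w" using c(3) w_nonneg mult_right_mono[of 1 "c * G" w] by simp
    also have "\<dots> = c * (G * w)" by simp
    also have "\<dots> \<le> c * (- D)" using c(1) \<open>G * w \<le> - D\<close> by (intro mult_left_mono) auto
    finally have w_le: "w \<le> - (c * D)" by simp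
    have "((\<lambda>s. \<theta> (H s)) has_real_derivative c * D) (at r)"
      by (rule DERIV_chain2[OF c(2) H])
    then have "\<forall>\<^sub>F s in at_right r. \<theta> (H s) - \<theta> (H r) \<le> (c * D + \<eta> / 2) * (s - r)"
      by (rule eventually_at_right_slope_le) (use \<eta> in auto)
    then show ?thesis
      using dist_le eventually_at_right_less
    proof eventually_elim
      case (elim s)
      have "dist (v r) (v s) + (\<theta> (H s) - \<theta> (H r)) \<le> ((w + \<eta> / 2) + (c * D + \<eta> / 2)) * (s - r)"
        using elim unfolding distrib_right by linarith
      also have "\<dots> \<le> \<eta> * (s - r)" using elim w_le by (intro mult_right_mono) auto
      finally show ?case by simp
    qed
  qed
qed

text \<open>By strict monotonicity \<open>\<theta>\<close> vanishes only at 0, so the null set in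
  \<open>KL_function\<close> contains every zero of \<open>\<theta>'\<close> except possibly 0. The
  point 0 is discarded as well, because \<open>KL_set\<close> demands nonzero relative energy.
  Elsewhere the sign of \<open>\<theta>'\<close> is that of the derivative of an increasing
  function.\<close>

lemma KL_function_AE:
  assumes "KL_function \<theta> \<theta>'"
  obtains N where "negligible N"
    "\<And>x. x \<notin> N \<Longrightarrow> x \<noteq> 0 \<and> 0 < \<theta>' x \<and> (\<theta> has_real_derivative \<theta>' x) (at x)"
proof -
  have KL: "strict_mono \<theta>" "\<theta> 0 = 0" "AE x in lborel. (\<theta> has_real_derivative \<theta>' x) (at x)"
      "{x. \<theta> x \<noteq> 0 \<and> \<theta>' x = 0} \<in> null_sets lebesgue"
    using assms by (auto simp: KL_function_def)
  define N1 where "N1 = {x. \<not> (\<theta> has_real_derivative \<theta>' x) (at x)}"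
  obtain N2 where "\<And>x. x \<in> space lborel - N2 \<Longrightarrow> (\<theta> has_real_derivative \<theta>' x) (at x)" "N2 \<in> null_sets lborel"
    by (rule AE_E3[OF KL(3)]) blast
  then have "N1 \<subseteq> N2" "N2 \<in> null_sets lborel" by (auto simp: N1_def)
  then have "negligible N1"
    by (meson negligible_iff_null_sets negligible_subset null_sets_completionI)
  then have neg: "negligible (N1 \<union> {x. \<theta> x \<noteq> 0 \<and> \<theta>' x = 0} \<union> {0})"
    using KL(4) by (auto simp: negligible_iff_null_sets[symmetric])
  have good: "x \<noteq> 0 \<and> 0 < \<theta>' x \<and> (\<theta> has_real_derivative \<theta>' x) (at x)"
    if x: "x \<notin> N1 \<union> {x. \<theta> x \<noteq> 0 \<and> \<theta>' x = 0} \<union> {0}" for x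
  proof -
    have deriv: "(\<theta> has_real_derivative \<theta>' x) (at x)" and "x \<noteq> 0" using x by (auto simp: N1_def)
    have "\<theta> x \<noteq> 0" using KL(1,2) \<open>x \<noteq> 0\<close> by (metis strict_mono_eq)
    then have "\<theta>' x \<noteq> 0" using x by auto
    moreover have "0 \<le> \<theta>' x"
    proof (rule ccontr)
      assume "\<not> ?thesis"
      then obtain d where "d > 0" "\<And>h. 0 < h \<Longrightarrow> h < d \<Longrightarrow> \<theta> (x + h) < \<theta> x"
        using DERIV_neg_dec_right[OF deriv] by force
      then have "\<theta> (x + d / 2) < \<theta> x" by simp
      with KL(1) \<open>d > 0\<close> show False by (simp add: strict_mono_less)
    qed
    ultimately show ?thesis using deriv \<open>x \<noteq> 0\<close> by simp
  qed
  show thesis by (rule that[OF neg good])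
qed

text \<open>Upward increments of \<open>G\<close> come from the distance alone, since
  \<open>\<theta> \<circ> H\<close> does not increase, and are thus bounded by the integral of
  \<open>m\<close>. This makes the almost everywhere bound on right slopes sufficient for
  \<open>G t \<le> G s\<close>.\<close>

lemma gradient_flow_length_le:
  fixes E :: "'a::metric_space \<Rightarrow> ereal"
  assumes p: "1 < p" and flow: "p_gradient_flow p E g v"
    and E: "\<forall>u. E u \<noteq> -\<infinity>" "E \<phi> = ereal e"
    and \<theta>: "KL_function \<theta> \<theta>'"
    and KL: "\<And>u. u \<in> KL_set E \<phi> \<epsilon> \<theta>' \<Longrightarrow> 1 \<le> ennreal (\<theta>' (real_of_ereal (rel_energy E \<phi> u))) * g u"
    and st: "0 < s" "s \<le> t" and in_ball: "\<And>r. s \<le> r \<Longrightarrow> r \<le> t \<Longrightarrow> v r \<in> ball \<phi> \<epsilon>"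
  shows "dist (v s) (v t) \<le> \<theta> (real_of_ereal (E (v s)) - e) - \<theta> (real_of_ereal (E (v t)) - e)"
proof -
  define H where "H r = real_of_ereal (E (v r)) - e" for r
  have mono: "x \<le> y \<Longrightarrow> \<theta> x \<le> \<theta> y" for x y
    using \<theta> by (simp add: KL_function_def strict_mono_less_eq)
  have H_anti: "H r' \<le> H r" if "0 < r" "r \<le> r'" for r r'
    using p_gradient_flow_real_energy_antimono[OF flow E(1) that] by (simp add: H_def)
  have rel: "rel_energy E \<phi> (v r) = ereal (H r)" if "0 < r" for r
    using p_gradient_flowD(2)[OF flow that] E by (cases "E (v r)") (auto simp: rel_energy_def H_def)
  obtain N where N: "negligible N"
      "\<And>x. x \<notin> N \<Longrightarrow> x \<noteq> 0 \<and> 0 < \<theta>' x \<and> (\<theta> has_real_derivative \<theta>' x) (at x)"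
    using KL_function_AE[OF \<theta>] by metis
  obtain m where m: "L1_loc 0 \<infinity> m"
      "\<And>s t. 0 < s \<Longrightarrow> s \<le> t \<Longrightarrow> dist (v s) (v t) \<le> (LINT r:{s..t}|lborel. m r)"
    using p_gradient_flowD(1)[OF flow] unfolding AC_loc_def by auto
  define G where "G x = dist (v s) (v x) + \<theta> (H x)" for x
  have "G t \<le> G s"
  proof (rule nonincreasing_if_right_slope_ae[OF st(2)])
    show "set_integrable lborel {s..t} m" using m(1) st by (simp add: L1_loc_def)
    fix r r' assume r: "s \<le> r" "r \<le> r'" "r' \<le> t"
    then have "dist (v s) (v r') \<le> dist (v s) (v r) + (LINT x:{r..r'}|lborel. m x)"
      using m(2)[of r r'] st dist_triangle[of "v s" "v r'" "v r"] by linarith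
    moreover have "\<theta> (H r') \<le> \<theta> (H r)" using r st by (intro mono H_anti) auto
    ultimately show "G r' - G r \<le> (LINT x:{r..r'}|lborel. m x)" by (simp add: G_def)
  next
    have "AE r in lborel. r \<notin> {r. H r \<in> N \<and> (\<exists>D. D \<noteq> 0 \<and> (H has_real_derivative D) (at r))}"
      by (intro negligible_imp_AE_lborel negligible_preimage_nonzero_derivative N(1))
    then show "AE r in lborel. s < r \<and> r < t \<longrightarrow>
        (\<forall>\<eta>>0. \<forall>\<^sub>F x in at_right r. G x \<le> G r + \<eta> * (x - r))"
      using p_gradient_flowD(4)[OF flow] AC_loc_metric_derivative[OF p_gradient_flowD(1)[OF flow]]
    proof eventually_elim
      case (elim r)
      show ?case
      proof (intro impI allI)
        fix \<eta> :: real assume r: "s < r \<and> r < t" and \<eta>: "0 < \<eta>"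
        then have "0 < r" using st by simp
        then obtain D where g_fin: "g (v r) < \<infinity>"
          and deriv: "((\<lambda>s. real_of_ereal (E (v s))) has_real_derivative D) (at r)"
          and D: "D \<le> - (1 / (p / (p - 1))) * enn2real (g (v r)) powr (p / (p - 1)) - (1 / p) * metric_derivative v r powr p"
          using elim(2) by blast
        have H_deriv: "(H has_real_derivative D) (at r)"
          unfolding H_def[abs_def] using DERIV_diff[OF deriv DERIV_const[of e]] by simp
        have "D = 0 \<or> (\<exists>c>0. (\<theta> has_real_derivative c) (at (H r)) \<and> 1 \<le> c * enn2real (g (v r)))"
        proof (cases "D = 0")
          case False
          then have "H r \<notin> N" using elim(1) H_deriv by blast
          \<comment> \<open>The first two facts place \<open>v r\<close> in \<open>KL_set\<close>;
            the third serves the chain rule.\<close>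
          then have x: "H r \<noteq> 0" "0 < \<theta>' (H r)" "(\<theta> has_real_derivative \<theta>' (H r)) (at (H r))"
            using N(2) by auto
          have "v r \<in> KL_set E \<phi> \<epsilon> \<theta>'"
            using x in_ball[of r] r rel[OF \<open>0 < r\<close>] p_gradient_flowD(2)[OF flow \<open>0 < r\<close>]
            by (simp add: KL_set_def eff_domain_def)
          then have "1 \<le> ennreal (\<theta>' (H r)) * g (v r)"
            using KL rel[OF \<open>0 < r\<close>] by force
          also have "\<dots> = ennreal (\<theta>' (H r) * enn2real (g (v r)))"
            using g_fin x(2) by (simp add: ennreal_mult)
          finally have "1 \<le> \<theta>' (H r) * enn2real (g (v r))" by simp
          with x show ?thesis by blast
        qed simp
        moreover have "\<forall>\<^sub>F x in at_right r. \<theta> (H x) \<le> \<theta> (H r)"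
          using eventually_at_right_less
          by eventually_elim (intro mono H_anti, use \<open>0 < r\<close> in auto)
        ultimately have "\<forall>\<^sub>F x in at_right r. dist (v r) (v x) + \<theta> (H x) \<le> \<theta> (H r) + \<eta> * (x - r)"
          using elim(3) \<open>0 < r\<close> by (intro gradient_flow_right_slope[OF p _ H_deriv D _ _ _ \<eta>]) auto
        then show "\<forall>\<^sub>F x in at_right r. G x \<le> G r + \<eta> * (x - r)"
        proof eventually_elim
          case (elim x)
          then show ?case using dist_triangle[of "v s" "v x" "v r"] by (simp add: G_def)
        qed
      qed
    qed
  qed
  then show ?thesis by (simp add: G_def H_def)
qed

text \<open>The \<open>g\<close> term of the energy inequality alone makes the energy fall at rate
  at least \<open>\<kappa>\<close>, so it would drop below \<open>B\<close> in finite time.\<close>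

lemma gradient_flow_slope_not_bounded_below:
  fixes E :: "'a::metric_space \<Rightarrow> ereal"
  assumes p: "1 < p" and flow: "p_gradient_flow p E g v" and E: "\<forall>u. E u \<noteq> -\<infinity>"
    and lower: "\<And>t. T \<le> t \<Longrightarrow> B \<le> real_of_ereal (E (v t))" and "0 < T" "0 < c"
    and slope: "\<And>t. T \<le> t \<Longrightarrow> ennreal c < g (v t)"
  shows False
proof -
  define \<kappa> where "\<kappa> = 1 / (p / (p - 1)) * c powr (p / (p - 1))"
  have "0 < \<kappa>" using p \<open>0 < c\<close> by (simp add: \<kappa>_def)
  define h where "h t = real_of_ereal (E (v t))" for t
  \<comment> \<open>As \<open>h\<close> does not increase, upward increments of
    \<open>h t + \<kappa> * t\<close> are at most those of the linear term; hence the constant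
    \<open>\<kappa>\<close> in the role of \<open>m\<close>.\<close>
  have bound: "h t + \<kappa> * t \<le> h T + \<kappa> * T" if "T \<le> t" for t
  proof (rule nonincreasing_if_right_slope_ae[OF that, where m = "\<lambda>_. \<kappa>"])
    show "set_integrable lborel {T..t} (\<lambda>_. \<kappa>)"
      by (simp add: set_integrable_def emeasure_lborel_Icc_eq)
    fix r r' assume r: "T \<le> r" "r \<le> r'" "r' \<le> t"
    have "h r' \<le> h r"
      unfolding h_def by (rule p_gradient_flow_real_energy_antimono[OF flow E]) (use r \<open>0 < T\<close> in auto)
    moreover have "(LINT x:{r..r'}|lborel. \<kappa>) = \<kappa> * (r' - r)"
      using r by (simp add: set_lebesgue_integral_def)
    ultimately show "h r' + \<kappa> * r' - (h r + \<kappa> * r) \<le> (LINT x:{r..r'}|lborel. \<kappa>)"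
      by (simp add: algebra_simps)
  next
    show "AE r in lborel. T < r \<and> r < t \<longrightarrow>
        (\<forall>\<eta>>0. \<forall>\<^sub>F s in at_right r. h s + \<kappa> * s \<le> h r + \<kappa> * r + \<eta> * (s - r))"
      using p_gradient_flowD(4)[OF flow]
    proof eventually_elim
      case (elim r)
      show ?case
      proof (intro impI allI)
        fix \<eta> :: real assume r: "T < r \<and> r < t" and \<eta>: "0 < \<eta>"
        then obtain D where g_fin: "g (v r) < \<infinity>" and deriv: "(h has_real_derivative D) (at r)"
          and D: "D \<le> - (1 / (p / (p - 1))) * enn2real (g (v r)) powr (p / (p - 1)) - (1 / p) * metric_derivative v r powr p"
          using elim \<open>0 < T\<close> unfolding h_def[abs_def] by force
        have "c \<le> enn2real (g (v r))"
          using slope[of r] r g_fin \<open>0 < c\<close>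
          by (metis enn2real_ennreal enn2real_mono infinity_ennreal_def less_imp_le)
        then have "c powr (p / (p - 1)) \<le> enn2real (g (v r)) powr (p / (p - 1))"
          using p \<open>0 < c\<close> by (intro powr_mono2) auto
        then have "\<kappa> \<le> 1 / (p / (p - 1)) * enn2real (g (v r)) powr (p / (p - 1))"
          unfolding \<kappa>_def using p by (intro mult_left_mono) auto
        moreover have "0 \<le> 1 / p * metric_derivative v r powr p" using p by simp
        ultimately have "D \<le> - \<kappa>" using D by linarith
        then have "\<forall>\<^sub>F s in at_right r. h s - h r \<le> (- \<kappa> + \<eta>) * (s - r)"
          using \<eta> by (intro eventually_at_right_slope_le[OF deriv]) auto
        then show "\<forall>\<^sub>F s in at_right r. h s + \<kappa> * s \<le> h r + \<kappa> * r + \<eta> * (s - r)"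
          by eventually_elim (simp add: algebra_simps)
      qed
    qed
  qed
  \<comment> \<open>At this time the guaranteed drop \<open>\<kappa> * (t - T)\<close> exceeds the
    available \<open>h T - B\<close> by 1.\<close>
  define t where "t = T + (h T - B + 1) / \<kappa>"
  have "B \<le> h T" using lower[of T] by (simp add: h_def)
  then have "T \<le> t" using \<open>0 < \<kappa>\<close> by (simp add: t_def)
  then have "B + \<kappa> * t \<le> h T + \<kappa> * T" using bound[of t] lower[of t] by (simp add: h_def)
  moreover have "\<kappa> * t = \<kappa> * T + (h T - B + 1)"
    using \<open>0 < \<kappa>\<close> unfolding t_def distrib_left by simp
  ultimately show False by simp
qed

section \<open>Stability and local minimality\<close>

lemma Lyapunov_stable_imp_local_minimum:
  fixes E :: "'a::complete_space \<Rightarrow> ereal" and g :: "'a \<Rightarrow> ennreal"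
  assumes p: "1 < p" and E: "\<forall>u. E u \<noteq> -\<infinity>" "lsc E" and g: "lsc g" and \<phi>: "\<phi> \<in> eff_domain E" and "0 < \<epsilon>"
    and lower: "\<forall>u \<in> ball \<phi> \<epsilon>. ereal c \<le> E u"
    and flows: "\<forall>v0 \<in> eff_domain E \<inter> ball \<phi> \<epsilon>. \<exists>v. p_gradient_flow p E g v \<and> initial_value v v0 \<and>
              (\<forall>t>0. E (v t) \<le> E v0)"
    and crit: "closure (ball \<phi> \<epsilon>) \<inter> {u. rel_energy E \<phi> u \<noteq> 0} \<subseteq> {u. g u > 0}"
    and KL: "KL_inequality E g \<phi> \<epsilon>"
    and stable: "Lyapunov_stable p E g \<phi>"
  shows "local_minimum E \<phi>"
proof (rule ccontr)
  assume not_min: "\<not> local_minimum E \<phi>"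
  obtain e where e: "E \<phi> = ereal e"
    using \<phi> E(1) by (cases "E \<phi>") (auto simp: eff_domain_def)
  obtain \<theta> \<theta>' where \<theta>: "KL_function \<theta> \<theta>'"
      "\<And>u. u \<in> KL_set E \<phi> \<epsilon> \<theta>' \<Longrightarrow> 1 \<le> ennreal (\<theta>' (real_of_ereal (rel_energy E \<phi> u))) * g u"
    using KL unfolding KL_inequality_def by auto
  obtain \<delta> where \<delta>: "0 < \<delta>" "\<And>v0 v t. v0 \<in> ball \<phi> \<delta> \<inter> eff_domain E \<Longrightarrow>
      p_gradient_flow p E g v \<Longrightarrow> initial_value v v0 \<Longrightarrow> 0 \<le> t \<Longrightarrow> v t \<in> ball \<phi> \<epsilon>"
    using stable \<open>0 < \<epsilon>\<close> unfolding Lyapunov_stable_def by meson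
  have "0 < min \<delta> \<epsilon>" using \<delta> \<open>0 < \<epsilon>\<close> by simp
  then obtain v0 where v0: "v0 \<in> ball \<phi> (min \<delta> \<epsilon>)" "E v0 < E \<phi>"
    using not_min \<phi> unfolding local_minimum_def by (meson not_le)
  have v0_dom: "v0 \<in> eff_domain E" using v0(2) e by (cases "E v0") (auto simp: eff_domain_def)
  then obtain v where v: "p_gradient_flow p E g v" "initial_value v v0" "\<And>t. 0 < t \<Longrightarrow> E (v t) \<le> E v0"
    using flows[rule_format, of v0] v0(1) by auto
  have in_ball: "v t \<in> ball \<phi> \<epsilon>" if "0 \<le> t" for t
    using \<delta>(2)[of v0 v t] v0 v0_dom v that by auto
  have lower': "c \<le> real_of_ereal (E (v t))" if "0 < t" for t
    using lower in_ball[of t] that p_gradient_flowD(2)[OF v(1) that] by (cases "E (v t)") force+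
  have mono: "x \<le> y \<Longrightarrow> \<theta> x \<le> \<theta> y" for x y
    using \<theta>(1) by (simp add: KL_function_def strict_mono_less_eq)
  \<comment> \<open>The flow conditions concern positive times only, so the length is measured from
    time 1.\<close>
  have "\<exists>l. (v \<longlongrightarrow> l) at_top"
  proof (rule finite_length_converges[of 1])
    fix s t :: real assume "1 \<le> s" "s \<le> t"
    then show "dist (v s) (v t) \<le> \<theta> (real_of_ereal (E (v s)) - e) - \<theta> (real_of_ereal (E (v t)) - e)"
      using in_ball by (intro gradient_flow_length_le[OF p v(1) E(1) e \<theta>]) auto
  next
    fix t :: real assume "1 \<le> t"
    then show "\<theta> (c - e) \<le> \<theta> (real_of_ereal (E (v t)) - e)"
      using lower'[of t] by (intro mono) auto
  qed
  then obtain l where l: "(v \<longlongrightarrow> l) at_top" ..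
  \<comment> \<open>Lower semicontinuity carries the bound by \<open>E v0\<close> to the limit; as
    \<open>E v0 < E \<phi>\<close>, the relative energy of \<open>l\<close> stays strictly
    negative.\<close>
  have "E l \<le> E v0"
  proof (rule ccontr)
    assume "\<not> ?thesis"
    then have "\<forall>\<^sub>F y in nhds l. E v0 < E y" by (intro lsc_imp_eventually_gt E(2)) auto
    then have "\<forall>\<^sub>F t in at_top. E v0 < E (v t)" using l unfolding filterlim_iff by blast
    then have "\<forall>\<^sub>F t in at_top. E v0 < E (v t) \<and> (0::real) < t"
      by (intro eventually_conj eventually_gt_at_top)
    then obtain t where "E v0 < E (v t)" "0 < t"
      by (auto simp: eventually_at_top_linorder)
    with v(3) show False by (meson leD)
  qed
  then have "E l < ereal e" using v0(2) e by simp
  then have "rel_energy E \<phi> l \<noteq> 0"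
    using e E(1) by (cases "E l") (auto simp: rel_energy_def zero_ereal_def)
  \<comment> \<open>The limit may leave the open ball, which is why the assumption on critical
    points concerns its closure.\<close>
  moreover have "l \<in> closure (ball \<phi> \<epsilon>)"
  proof (rule Lim_in_closed_set[OF _ _ _ l])
    show "\<forall>\<^sub>F t in at_top. v t \<in> closure (ball \<phi> \<epsilon>)"
      using eventually_ge_at_top[of 0]
      by eventually_elim (use in_ball closure_subset in blast)
  qed auto
  ultimately have "0 < g l" using crit by auto
  \<comment> \<open>Lower semicontinuity of \<open>g\<close> turns positivity at the limit into a
    positive lower bound along a whole tail of the flow, which bounded energy does not
    permit.\<close>
  then obtain k where k: "0 < k" "k < g l" using dense by blast
  then obtain r where r: "k = ennreal r" "0 < r"
    by (cases k) auto
  have "\<forall>\<^sub>F y in nhds l. k < g y" by (rule lsc_imp_eventually_gt[OF g k(2)])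
  then have "\<forall>\<^sub>F t in at_top. k < g (v t)" using l unfolding filterlim_iff by blast
  then obtain T where T: "\<And>t. T \<le> t \<Longrightarrow> k < g (v t)"
    by (auto simp: eventually_at_top_linorder)
  show False
    by (rule gradient_flow_slope_not_bounded_below[OF p v(1) E(1), of "max T 1" c r])
       (use T lower' r in auto)
qed

text \<open>This is a first exit argument for the ball of radius \<open>\<rho>\<close>: as long as
  the flow stays inside, the length bound keeps it within
  \<open>\<rho> / 2 + \<theta> \<eta>\<close> of \<open>\<phi>\<close>, which is less than
  \<open>\<rho>\<close>.\<close>

lemma local_minimum_imp_Lyapunov_stable:
  fixes E :: "'a::metric_space \<Rightarrow> ereal" and g :: "'a \<Rightarrow> ennreal"
  assumes p: "1 < p" and E: "\<forall>u. E u \<noteq> -\<infinity>" and g: "g \<phi> = 0"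
    and small: "\<forall>\<eta>::real. \<eta> > 0 \<longrightarrow> (\<exists>\<delta>. 0 < \<delta> \<and> \<delta> \<le> \<epsilon> \<and>
              (\<forall>u \<in> ball \<phi> \<delta> \<inter> eff_domain E. rel_energy E \<phi> u < ereal \<eta>))"
    and KL: "KL_inequality E g \<phi> \<epsilon>"
    and min: "local_minimum E \<phi>"
  shows "Lyapunov_stable p E g \<phi>"
  unfolding Lyapunov_stable_def
proof (intro conjI allI impI g)
  fix \<epsilon>' :: real assume "0 < \<epsilon>'"
  obtain r where r: "0 < r" "\<And>u. u \<in> ball \<phi> r \<Longrightarrow> E \<phi> \<le> E u" and \<phi>: "E \<phi> < \<infinity>"
    using min unfolding local_minimum_def eff_domain_def by auto
  obtain e where e: "E \<phi> = ereal e" using \<phi> E by (cases "E \<phi>") auto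
  obtain \<theta> \<theta>' where \<theta>: "KL_function \<theta> \<theta>'"
      "\<And>u. u \<in> KL_set E \<phi> \<epsilon> \<theta>' \<Longrightarrow> 1 \<le> ennreal (\<theta>' (real_of_ereal (rel_energy E \<phi> u))) * g u"
    using KL unfolding KL_inequality_def by auto
  have \<theta>': "strict_mono \<theta>" "\<theta> 0 = 0" "continuous_on UNIV \<theta>"
    using \<theta>(1) by (auto simp: KL_function_def W11_loc_def)
  have "0 < \<epsilon>" using small by (meson less_le_trans zero_less_one)
  \<comment> \<open>The three radii stand for the target ball, the ball of the Kurdyka-Lojasiewicz
    inequality and the ball of minimality.\<close>
  define \<rho> where "\<rho> = Min {\<epsilon>', \<epsilon>, r}"
  have \<rho>: "0 < \<rho>" "\<rho> \<le> \<epsilon>'" "\<rho> \<le> \<epsilon>" "\<rho> \<le> r"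
    using \<open>0 < \<epsilon>'\<close> \<open>0 < \<epsilon>\<close> r(1) by (auto simp: \<rho>_def)
  obtain \<eta> where \<eta>: "0 < \<eta>" "\<theta> \<eta> < \<rho> / 2"
  proof -
    have "isCont \<theta> 0" using \<theta>'(3) by (simp add: continuous_on_eq_continuous_at)
    then obtain d where "d > 0" "\<And>x. \<bar>x\<bar> < d \<Longrightarrow> \<bar>\<theta> x\<bar> < \<rho> / 2"
      using \<rho>(1) \<theta>'(2) unfolding continuous_at_eps_delta dist_real_def by (metis diff_zero half_gt_zero)
    moreover from this have "\<bar>\<theta> (d / 2)\<bar> < \<rho> / 2" by simp
    ultimately show thesis by (intro that[of "d / 2"]) (simp, linarith)
  qed
  obtain \<delta>0 where \<delta>0: "0 < \<delta>0" "\<And>u. u \<in> ball \<phi> \<delta>0 \<Longrightarrow> E u < \<infinity> \<Longrightarrow> rel_energy E \<phi> u < ereal \<eta>"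
    using small \<eta>(1) unfolding eff_domain_def by blast
  define \<delta> where "\<delta> = min \<delta>0 (\<rho> / 2)"
  have "0 < \<delta>" using \<delta>0 \<rho> by (simp add: \<delta>_def)
  have "v t \<in> ball \<phi> \<epsilon>'"
    if v0: "v0 \<in> ball \<phi> \<delta> \<inter> eff_domain E" and v: "p_gradient_flow p E g v" "initial_value v v0" and "0 \<le> t"
    for v0 v t
  proof -
    define H where "H r = real_of_ereal (E (v r)) - e" for r
    have rel: "rel_energy E \<phi> (v r) = ereal (H r)" "E (v r) = ereal (H r + e)" if "0 < r" for r
      using p_gradient_flowD(2)[OF v(1) that] E e by (cases "E (v r)"; auto simp: rel_energy_def H_def)+
    have lim: "(v \<longlongrightarrow> v0) (at_right 0)" "v 0 = v0" using v(2) by (auto simp: initial_value_def)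
    have "\<forall>\<^sub>F x in at_right 0. v x \<in> ball \<phi> \<delta>"
      using topological_tendstoD[OF lim(1), of "ball \<phi> \<delta>"] v0 by auto
    then obtain b where b: "0 < b" "\<And>x. 0 < x \<Longrightarrow> x < b \<Longrightarrow> v x \<in> ball \<phi> \<delta>"
      by (auto simp: eventually_at_right[of 0 1])
    define s where "s = b / 2"
    have s: "0 < s" "\<And>x. 0 \<le> x \<Longrightarrow> x \<le> s \<Longrightarrow> v x \<in> ball \<phi> \<delta>"
    proof -
      show "0 < s" using b by (simp add: s_def)
      fix x assume "0 \<le> x" "x \<le> s"
      then show "v x \<in> ball \<phi> \<delta>" using b lim(2) v0 by (cases "x = 0") (auto simp: s_def)
    qed
    \<comment> \<open>The energy bound is taken at \<open>v s\<close>, which is still close to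
      \<open>\<phi>\<close>, and not at \<open>v0\<close>: energies at positive times need not be
      bounded by \<open>E v0\<close>.\<close>
    have "H s < \<eta>"
      using \<delta>0(2)[of "v s"] s rel[of s] by (auto simp: \<delta>_def)
    have trap: "dist \<phi> (v y) < \<rho> / 2 + \<theta> \<eta>"
      if y: "s \<le> y" and inside: "\<And>x. s \<le> x \<Longrightarrow> x \<le> y \<Longrightarrow> v x \<in> ball \<phi> \<rho>" for y
    proof -
      have "dist (v s) (v y) \<le> \<theta> (H s) - \<theta> (H y)"
        unfolding H_def using inside \<rho>(3) s(1) y
        by (intro gradient_flow_length_le[OF p v(1) E e \<theta>]) (auto intro: less_le_trans)
      moreover have "\<theta> (H s) < \<theta> \<eta>" using \<open>H s < \<eta>\<close> \<theta>'(1) by (simp add: strict_mono_less)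
      moreover have "0 \<le> H y"
        using r(2)[of "v y"] inside[of y] y \<rho>(4) e rel(2)[of y] s(1) by auto
      then have "0 \<le> \<theta> (H y)" using \<theta>'(1,2) by (metis strict_mono_less_eq)
      moreover have "dist \<phi> (v s) < \<rho> / 2" using s(2)[of s] s(1) by (simp add: \<delta>_def)
      ultimately show ?thesis using dist_triangle[of \<phi> "v y" "v s"] by linarith
    qed
    have cont: "continuous_on A (\<lambda>y. dist \<phi> (v y))" if "A \<subseteq> {0<..}" for A
      using AC_loc_continuous_on[OF p_gradient_flowD(1)[OF v(1)]] that
      by (intro continuous_intros) (rule continuous_on_subset)
    have "v x \<in> ball \<phi> \<rho>" if "s \<le> x" for x
    proof (rule ccontr)
      assume "v x \<notin> ball \<phi> \<rho>"
      define Z where "Z = {y\<in>{s..x}. \<rho> \<le> dist \<phi> (v y)}"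
      have "closed Z"
        unfolding Z_def using s(1) by (intro continuous_on_closed_Collect_le cont continuous_on_const) auto
      moreover have Z: "x \<in> Z" "bdd_below Z"
        using \<open>s \<le> x\<close> \<open>v x \<notin> ball \<phi> \<rho>\<close> by (auto simp: Z_def intro: bdd_belowI[of _ s])
      ultimately have "Inf Z \<in> Z" by (intro closed_contains_Inf) auto
      define T where "T = Inf Z"
      have T: "s \<le> T" "T \<le> x" "\<rho> \<le> dist \<phi> (v T)"
        using \<open>Inf Z \<in> Z\<close> by (auto simp: Z_def T_def)
      have "T \<noteq> s" using T(3) s(2)[of s] s(1) \<rho>(1) by (auto simp: \<delta>_def)
      then have "s < T" using T by simp
      have before: "v y \<in> ball \<phi> \<rho>" if "s \<le> y" "y < T" for y
      proof -
        have "y \<notin> Z" using that cInf_lower[OF _ Z(2), of y] by (auto simp: T_def)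
        then show ?thesis using that T by (auto simp: Z_def)
      qed
      \<comment> \<open>At the first exit time \<open>T\<close> the flow has left the open ball, so
        \<open>trap\<close> applies only before \<open>T\<close>. Continuity extends its bound to
        \<open>T\<close>, and the weak inequality still contradicts
        \<open>\<theta> \<eta> < \<rho> / 2\<close>.\<close>
      have "dist \<phi> (v T) \<le> \<rho> / 2 + \<theta> \<eta>"
      proof (rule continuous_le_on_closure[of "{s..<T}" "\<lambda>y. dist \<phi> (v y)" T])
        show "continuous_on (closure {s..<T}) (\<lambda>y. dist \<phi> (v y))"
          using \<open>s < T\<close> s(1) by (intro cont) auto
        show "T \<in> closure {s..<T}" using \<open>s < T\<close> by simp
        show "dist \<phi> (v y) \<le> \<rho> / 2 + \<theta> \<eta>" if "y \<in> {s..<T}" for y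
          using trap[of y] before that by fastforce
      qed
      then show False using T(3) \<eta>(2) by linarith
    qed
    moreover have "v x \<in> ball \<phi> \<rho>" if "0 \<le> x" "x \<le> s" for x
      using s(2)[OF that] \<rho>(1) by (auto simp: \<delta>_def)
    ultimately have "v t \<in> ball \<phi> \<rho>" using \<open>0 \<le> t\<close> by (meson linear)
    then show ?thesis using \<rho>(2) by auto
  qed
  with \<open>0 < \<delta>\<close> show "\<exists>\<delta>>0. \<forall>v0 \<in> ball \<phi> \<delta> \<inter> eff_domain E. \<forall>v.
        p_gradient_flow p E g v \<and> initial_value v v0 \<longrightarrow> (\<forall>t\<ge>0. v t \<in> ball \<phi> \<epsilon>')"
    by blast
qed

theorem theorem3p28:
  fixes E :: "'a::complete_space \<Rightarrow> ereal" and g :: "'a \<Rightarrow> ennreal" and p :: real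
  assumes "1 < p"
    and "\<forall>u. E u \<noteq> -\<infinity>"
    and "\<exists>u. E u < \<infinity>"
    and "lsc E"
    and "strong_upper_gradient E g"
  shows
    "(\<forall>\<phi>. lsc g \<and> g \<phi> = 0 \<and>
        (\<exists>\<epsilon>>0.
           (\<exists>c::real. \<forall>u \<in> ball \<phi> \<epsilon>. ereal c \<le> E u) \<and>
           (\<forall>v0 \<in> eff_domain E \<inter> ball \<phi> \<epsilon>. \<exists>v. p_gradient_flow p E g v \<and> initial_value v v0 \<and>
              (\<forall>t>0. E (v t) \<le> E v0)) \<and>
           closure (ball \<phi> \<epsilon>) \<inter> {u. rel_energy E \<phi> u \<noteq> 0} \<subseteq> {u. g u > 0} \<and>
           KL_inequality E g \<phi> \<epsilon>)
      \<longrightarrow> Lyapunov_stable p E g \<phi> \<longrightarrow> local_minimum E \<phi>)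
     \<and>
     (\<forall>\<phi>. g \<phi> = 0 \<and>
        (\<exists>\<epsilon>>0.
           (\<forall>\<eta>::real. \<eta> > 0 \<longrightarrow> (\<exists>\<delta>. 0 < \<delta> \<and> \<delta> \<le> \<epsilon> \<and>
              (\<forall>u \<in> ball \<phi> \<delta> \<inter> eff_domain E. rel_energy E \<phi> u < ereal \<eta>))) \<and>
           closure (ball \<phi> \<epsilon>) \<inter> {u. rel_energy E \<phi> u \<noteq> 0} \<subseteq> {u. g u > 0} \<and>
           KL_inequality E g \<phi> \<epsilon>)
      \<longrightarrow> local_minimum E \<phi> \<longrightarrow> Lyapunov_stable p E g \<phi>)"
proof (intro conjI allI impI)
  fix \<phi>
  assume "lsc g \<and> g \<phi> = 0 \<and>
        (\<exists>\<epsilon>>0.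
           (\<exists>c::real. \<forall>u \<in> ball \<phi> \<epsilon>. ereal c \<le> E u) \<and>
           (\<forall>v0 \<in> eff_domain E \<inter> ball \<phi> \<epsilon>. \<exists>v. p_gradient_flow p E g v \<and> initial_value v v0 \<and>
              (\<forall>t>0. E (v t) \<le> E v0)) \<and>
           closure (ball \<phi> \<epsilon>) \<inter> {u. rel_energy E \<phi> u \<noteq> 0} \<subseteq> {u. g u > 0} \<and>
           KL_inequality E g \<phi> \<epsilon>)"
    and stable: "Lyapunov_stable p E g \<phi>"
  then obtain \<epsilon> c where "lsc g" "g \<phi> = 0" "0 < \<epsilon>" "\<forall>u \<in> ball \<phi> \<epsilon>. ereal c \<le> E u"
    "\<forall>v0 \<in> eff_domain E \<inter> ball \<phi> \<epsilon>. \<exists>v. p_gradient_flow p E g v \<and> initial_value v v0 \<and> (\<forall>t>0. E (v t) \<le> E v0)"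
    "closure (ball \<phi> \<epsilon>) \<inter> {u. rel_energy E \<phi> u \<noteq> 0} \<subseteq> {u. g u > 0}" "KL_inequality E g \<phi> \<epsilon>"
    by blast
  \<comment> \<open>A strong upper gradient is finite only on the effective domain, and
    \<open>g \<phi> = 0\<close> is finite.\<close>
  moreover have "\<phi> \<in> eff_domain E"
    using assms(5) \<open>g \<phi> = 0\<close> unfolding strong_upper_gradient_def by auto
  ultimately show "local_minimum E \<phi>"
    using Lyapunov_stable_imp_local_minimum[OF assms(1,2,4)] stable by blast
next
  fix \<phi>
  assume "g \<phi> = 0 \<and>
        (\<exists>\<epsilon>>0.
           (\<forall>\<eta>::real. \<eta> > 0 \<longrightarrow> (\<exists>\<delta>. 0 < \<delta> \<and> \<delta> \<le> \<epsilon> \<and>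
              (\<forall>u \<in> ball \<phi> \<delta> \<inter> eff_domain E. rel_energy E \<phi> u < ereal \<eta>))) \<and>
           closure (ball \<phi> \<epsilon>) \<inter> {u. rel_energy E \<phi> u \<noteq> 0} \<subseteq> {u. g u > 0} \<and>
           KL_inequality E g \<phi> \<epsilon>)"
    and "local_minimum E \<phi>"
  then show "Lyapunov_stable p E g \<phi>"
    using local_minimum_imp_Lyapunov_stable[OF assms(1,2)] by blast
qed

end
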